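(* Let $n=2^k$ with $k\ge 0$ an integer. Then there is a positive definite symmetric bilinear form on the $\mathbb Q$-vector space $\mathbb Q^{3n}$ such that, in the modular ortholattice $\mathcal L(\mathbb Q^{3n})$ of all linear subspaces of $\mathbb Q^{3n}$ with orthocomplementation $X\mapsto X'$ given by the form, the subspaces $$\tilde E_i=\sum_{t=1}^{n} e_{t+(i-1)n}\mathbb Q,\qquad \tilde E_{ij}=\sum_{t=1}^{n}(e_{t+(i-1)n}-e_{t+(j-1)n})\mathbb Q\qquad (i,j\in\{1,2,3\},\ i\ne j)$$ form an orthogonal $3$-frame which generates $\mathcal L(\mathbb Q^{3n})$ as an ortholattice.
   Context: Here $e_1,\dots,e_{3n}$ is the standard basis of $\mathbb Q^{3n}$. The listed subspaces are the image of the canonical $3$-frame $E_i=e_i\mathbb Q_n$, $E_{ij}=(e_i-e_j)\mathbb Q_n$ of the lattice of right submodules of $(\mathbb Q_n)^3$ ($\mathbb Q_n$ the ring of $n\times n$-matrices over $\mathbb Q$) under its canonical isomorphism with $\mathcal L(\mathbb Q^{3n})$, which sends a submodule to the set of columns occurring in its elements. A modular ortholattice (MOL) is a bounded modular lattice (join $+$, meet written as product) with an order-reversing involution $x\mapsto x'$ such that $x+x'=1$ and $xx'=0$. "Generates as an ortholattice" means: the smallest subset containing the given elements and closed under $+,\cdot,{}',0,1$ is the whole MOL. For a positive definite symmetric bilinear form $\Phi$, $X'=\{y:\Phi(y,x)=0\ \forall x\in X\}$. An $n$-frame ($n\ge3$) in a lattice is a list of elements $a_i,a_{ij}$ ($1\le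 i,j\le n$, $i\neq j$) such that for any three distinct $j,k,l$: $a_j\sum_{i\ne j}a_i=\prod_i a_i=a_ja_{jk}$, $a_j+a_{jk}=a_j+a_k$, and $a_{jl}=a_{lj}=(a_j+a_l)(a_{jk}+a_{kl})$. In an MOL, a frame is orthogonal if $a_j\le a_k'$ for all $j\ne k$. *)

theory Defs
  imports "Jordan_Normal_Form.VS_Connect"
begin

section \<open>Modular ortholattices\<close>

record 'a ortholattice = "'a gorder" +
  ocompl :: "'a \<Rightarrow> 'a"

locale modular_ortholattice = Lattice.bounded_lattice L
  for L :: "('a, 'b) ortholattice_scheme" (structure) +
  assumes modular:
      "\<lbrakk>x \<in> carrier L; y \<in> carrier L; z \<in> carrier L; x \<sqsubseteq> z\<rbrakk>
        \<Longrightarrow> x \<squnion> (y \<sqinter> z) = (x \<squnion> y) \<sqinter> z"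
    and ocompl_closed: "x \<in> carrier L \<Longrightarrow> ocompl L x \<in> carrier L"
    and ocompl_involution: "x \<in> carrier L \<Longrightarrow> ocompl L (ocompl L x) = x"
    and ocompl_antitone:
      "\<lbrakk>x \<in> carrier L; y \<in> carrier L; x \<sqsubseteq> y\<rbrakk> \<Longrightarrow> ocompl L y \<sqsubseteq> ocompl L x"
    and join_ocompl: "x \<in> carrier L \<Longrightarrow> x \<squnion> ocompl L x = \<top>"
    and meet_ocompl: "x \<in> carrier L \<Longrightarrow> x \<sqinter> ocompl L x = \<bottom>"

inductive_set ortho_generated :: "('a, 'b) ortholattice_scheme \<Rightarrow> 'a set \<Rightarrow> 'a set"
  for L (structure) and S where
  base: "x \<in> S \<Longrightarrow> x \<in> ortho_generated L S"
| join: "\<lbrakk>x \<in> ortho_generated L S; y \<in> ortho_generated L S\<rbrakk> \<Longrightarrow> x \<squnion> y \<in> ortho_generated L S"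
| meet: "\<lbrakk>x \<in> ortho_generated L S; y \<in> ortho_generated L S\<rbrakk> \<Longrightarrow> x \<sqinter> y \<in> ortho_generated L S"
| ocompl: "x \<in> ortho_generated L S \<Longrightarrow> ocompl L x \<in> ortho_generated L S"
| bottom: "\<bottom> \<in> ortho_generated L S"
| top: "\<top> \<in> ortho_generated L S"


section \<open>Frames\<close>

text \<open>The elements \<open>a i\<close> and \<open>b i j\<close> matter only for indices in \<open>{1..N}\<close>
  and, in the case of \<open>b\<close>, for \<open>i \<noteq> j\<close>.\<close>

definition frame ::
  "('a, 'b) gorder_scheme \<Rightarrow> nat \<Rightarrow> (nat \<Rightarrow> 'a) \<Rightarrow> (nat \<Rightarrow> nat \<Rightarrow> 'a) \<Rightarrow> bool" where
  "frame L N a b \<longleftrightarrow>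
     N \<ge> 3 \<and>
     (\<forall>i\<in>{1..N}. a i \<in> carrier L) \<and>
     (\<forall>i\<in>{1..N}. \<forall>j\<in>{1..N}. i \<noteq> j \<longrightarrow> b i j \<in> carrier L) \<and>
     (\<forall>j\<in>{1..N}. \<forall>k\<in>{1..N}. \<forall>l\<in>{1..N}. j \<noteq> k \<and> k \<noteq> l \<and> j \<noteq> l \<longrightarrow>
        a j \<sqinter>\<^bsub>L\<^esub> (\<Squnion>\<^bsub>L\<^esub> (a ` ({1..N} - {j}))) = \<Sqinter>\<^bsub>L\<^esub> (a ` {1..N}) \<and>
        \<Sqinter>\<^bsub>L\<^esub> (a ` {1..N}) = a j \<sqinter>\<^bsub>L\<^esub> b j k \<and>
        a j \<squnion>\<^bsub>L\<^esub> b j k = a j \<squnion>\<^bsub>L\<^esub> a k \<and>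
        b j l = b l j \<and>
        b l j = (a j \<squnion>\<^bsub>L\<^esub> a l) \<sqinter>\<^bsub>L\<^esub> (b j k \<squnion>\<^bsub>L\<^esub> b k l))"

definition orthogonal_frame ::
  "('a, 'b) ortholattice_scheme \<Rightarrow> nat \<Rightarrow> (nat \<Rightarrow> 'a) \<Rightarrow> (nat \<Rightarrow> nat \<Rightarrow> 'a) \<Rightarrow> bool" where
  "orthogonal_frame L N a b \<longleftrightarrow>
     frame L N a b \<and>
     (\<forall>j\<in>{1..N}. \<forall>k\<in>{1..N}. j \<noteq> k \<longrightarrow> a j \<sqsubseteq>\<^bsub>L\<^esub> ocompl L (a k))"


section \<open>Forms and the ortholattice of subspaces\<close>

definition symmetric_bilinear_form ::
  "nat \<Rightarrow> ('a::field vec \<Rightarrow> 'a vec \<Rightarrow> 'a) \<Rightarrow> bool" where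
  "symmetric_bilinear_form d \<Phi> \<longleftrightarrow>
     (\<forall>x\<in>carrier_vec d. \<forall>y\<in>carrier_vec d. \<forall>z\<in>carrier_vec d.
        \<Phi> (x + y) z = \<Phi> x z + \<Phi> y z \<and> \<Phi> x (y + z) = \<Phi> x y + \<Phi> x z) \<and>
     (\<forall>c. \<forall>x\<in>carrier_vec d. \<forall>y\<in>carrier_vec d.
        \<Phi> (c \<cdot>\<^sub>v x) y = c * \<Phi> x y \<and> \<Phi> x (c \<cdot>\<^sub>v y) = c * \<Phi> x y) \<and>
     (\<forall>x\<in>carrier_vec d. \<forall>y\<in>carrier_vec d. \<Phi> x y = \<Phi> y x)"

definition positive_definite ::
  "nat \<Rightarrow> ('a::linordered_field vec \<Rightarrow> 'a vec \<Rightarrow> 'a) \<Rightarrow> bool" where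
  "positive_definite d \<Phi> \<longleftrightarrow> (\<forall>x\<in>carrier_vec d. x \<noteq> 0\<^sub>v d \<longrightarrow> \<Phi> x x > 0)"

definition subspace_ortholattice ::
  "nat \<Rightarrow> ('a::field vec \<Rightarrow> 'a vec \<Rightarrow> 'a) \<Rightarrow> 'a vec set ortholattice" where
  "subspace_ortholattice d \<Phi> =
     \<lparr>carrier = {W. VectorSpace.subspace class_ring W (module_vec TYPE('a) d)},
      eq = (=),
      le = (\<subseteq>),
      ocompl = (\<lambda>X. {y \<in> carrier_vec d. \<forall>x\<in>X. \<Phi> y x = 0})\<rparr>"

text \<open>\<open>unit_vec d\<close> counts coordinates from \<open>0\<close>, so the basis vector \<open>e\<^sub>s\<close> with
  \<open>1 \<le> s \<le> d\<close> is \<open>unit_vec d (s - 1)\<close>.\<close>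

definition std_basis_vec :: "nat \<Rightarrow> nat \<Rightarrow> rat vec" where
  "std_basis_vec d s = unit_vec d (s - 1)"

definition E_tilde :: "nat \<Rightarrow> nat \<Rightarrow> rat vec set" where
  "E_tilde n i =
     LinearCombinations.module.span class_ring (module_vec TYPE(rat) (3 * n))
       ((\<lambda>t. std_basis_vec (3 * n) (t + (i - 1) * n)) ` {1..n})"

definition E2_tilde :: "nat \<Rightarrow> nat \<Rightarrow> nat \<Rightarrow> rat vec set" where
  "E2_tilde n i j =
     LinearCombinations.module.span class_ring (module_vec TYPE(rat) (3 * n))
       ((\<lambda>t. std_basis_vec (3 * n) (t + (i - 1) * n) - std_basis_vec (3 * n) (t + (j - 1) * n))
          ` {1..n})"

end

theory Submission
  imports Defs
begin

text \<open>For a block diagonal form with blocks \<open>1\<close>, \<open>A\<^sub>2\<close>, \<open>A\<^sub>3\<close>, consider the matrices \<open>M\<close> whose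
  graphs \<open>{(x, - M x)}\<close> between two blocks are generated by the frame. As in von Staudt's
  coordinatization they form a ring, closed under existing inverses and hence a
  \<open>\<rat>\<close>-algebra; the orthocomplement of the frame element with indices \<open>1\<close>, \<open>j\<close> puts \<open>A\<^sub>j\<close> into
  this ring. With \<open>A\<^sub>2 = diag (1, \<dots>, n)\<close> and \<open>A\<^sub>3 = 1 + J\<close>, where all entries of \<open>J\<close> are \<open>1\<close>,
  Lagrange interpolation at \<open>A\<^sub>2\<close> yields the diagonal matrix units and multiplying \<open>J\<close> by them
  on both sides yields the others, so the ring is the full matrix ring. Graphs of rank one
  matrices then cut out every line, and lines span everything.\<close>

section \<open>Subspaces of coordinate space\<close>

text \<open>The blocks of the form cannot all be alike. With the standard form, the subspaces U
  \<otimes> Q^n with U a subspace of Q^3 contain the frame and are closed under sums, intersections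
  and complements, so the ring would stop at the scalar matrices. If \<open>A_2\<close> and
  \<open>A_3\<close> were both diagonal, every generated subspace would split along the n orthogonal
  copies of Q^3, one for each coordinate inside a block. The choice therefore lets one matrix
  separate the coordinates and the other mix them: pairwise distinct diagonal entries do the former,
  and J does the latter because it has no zero entry. J alone is only semidefinite for n > 1, hence
  1 + J.

  Lattice terms offer no multiplication by rationals either. Integer scalars arise from 1 by
  differences, and the reciprocal of a scalar has the same graph read in the opposite direction. The
  third block is the auxiliary room in which graphs between the other two are composed and
  subtracted.\<close>

definition lin_subspace :: "nat \<Rightarrow> 'a::field vec set \<Rightarrow> bool" where
  "lin_subspace d W \<longleftrightarrow> W \<subseteq> carrier_vec d \<and> 0\<^sub>v d \<in> W \<and>
     (\<forall>x\<in>W. \<forall>y\<in>W. x + y \<in> W) \<and> (\<forall>c. \<forall>x\<in>W. c \<cdot>\<^sub>v x \<in> W)"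

definition vsum :: "'a::field vec set \<Rightarrow> 'a vec set \<Rightarrow> 'a vec set" where
  "vsum X Y = {x + y | x y. x \<in> X \<and> y \<in> Y}"

definition line :: "'a::field vec \<Rightarrow> 'a vec set" where
  "line v = range (\<lambda>c. c \<cdot>\<^sub>v v)"

lemma lin_subspaceD:
  assumes "lin_subspace d W"
  shows "x \<in> W \<Longrightarrow> x \<in> carrier_vec d" "0\<^sub>v d \<in> W"
    "x \<in> W \<Longrightarrow> y \<in> W \<Longrightarrow> x + y \<in> W" "x \<in> W \<Longrightarrow> c \<cdot>\<^sub>v x \<in> W"
  using assms by (auto simp: lin_subspace_def)

lemma lin_subspace_diff:
  assumes "lin_subspace d W" "x \<in> W" "y \<in> W"
  shows "x - y \<in> W"
proof -
  have "x - y = x + (-1) \<cdot>\<^sub>v y"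
    using lin_subspaceD(1)[OF assms(1)] assms by (intro eq_vecI) auto
  thus ?thesis using lin_subspaceD[OF assms(1)] assms by simp
qed

text \<open>Bridges the module-theoretic notion in the carrier to elementary closure conditions, in
  which the later arguments are carried out.\<close>

lemma lin_subspace_iff:
  "VectorSpace.subspace class_ring W (module_vec TYPE('a::field) d) \<longleftrightarrow> lin_subspace d W"
proof -
  interpret vec_space "TYPE('a)" d .
  show ?thesis
  proof
    assume "VectorSpace.subspace class_ring W V"
    then interpret s: submodule class_ring W V by (rule VectorSpace.subspace.submod)
    have z: "0\<^sub>v d \<in> W" using s.zero_closed by simp
    show "lin_subspace d W" unfolding lin_subspace_def
      using s.subset s.m_closed s.smult_closed z by (auto simp: class_ring_simps)
  next
    assume W: "lin_subspace d W"
    have "submodule class_ring W V"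
    proof (rule submodule.intro)
      show "Module.module class_ring V" by (rule module_axioms)
    qed (use W in \<open>auto simp: lin_subspace_def class_ring_simps\<close>)
    thus "VectorSpace.subspace class_ring W V"
      using VectorSpace.subspace.intro vectorspace_axioms by blast
  qed
qed

text \<open>The second summand is determined by the first, so later proofs only choose
  \<open>x\<close> and check that the remainder lies in \<open>Y\<close>.\<close>

lemma mem_vsum:
  assumes "lin_subspace d X" "lin_subspace d Y"
  shows "v \<in> vsum X Y \<longleftrightarrow> v \<in> carrier_vec d \<and> (\<exists>x\<in>X. v - x \<in> Y)"
proof
  assume "v \<in> vsum X Y"
  then obtain x y where v: "v = x + y" "x \<in> X" "y \<in> Y" by (auto simp: vsum_def)
  have c: "x \<in> carrier_vec d" "y \<in> carrier_vec d"
    using v assms by (auto dest: lin_subspaceD(1))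
  have "v - x = y" using c v(1) by (intro eq_vecI) auto
  thus "v \<in> carrier_vec d \<and> (\<exists>x\<in>X. v - x \<in> Y)"
    using v c by (intro conjI bexI[of _ x]) auto
next
  assume "v \<in> carrier_vec d \<and> (\<exists>x\<in>X. v - x \<in> Y)"
  then obtain x where v: "v \<in> carrier_vec d" "x \<in> X" "v - x \<in> Y" by auto
  have c: "x \<in> carrier_vec d" using v assms by (auto dest: lin_subspaceD(1))
  have "v = x + (v - x)" using c v(1) by (intro eq_vecI) auto
  thus "v \<in> vsum X Y" using v by (auto simp: vsum_def)
qed

lemma lin_subspace_vsum:
  assumes X: "lin_subspace d X" and Y: "lin_subspace d Y"
  shows "lin_subspace d (vsum X Y)"
proof -
  note cX = lin_subspaceD[OF X] and cY = lin_subspaceD[OF Y]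
  show ?thesis unfolding lin_subspace_def
  proof (intro conjI ballI allI)
    show "vsum X Y \<subseteq> carrier_vec d" using cX(1) cY(1) by (auto simp: vsum_def)
    have "0\<^sub>v d = 0\<^sub>v d + (0\<^sub>v d :: 'a vec)" by simp
    thus "0\<^sub>v d \<in> vsum X Y" using cX(2) cY(2) unfolding vsum_def by blast
  next
    fix u v assume "u \<in> vsum X Y" "v \<in> vsum X Y"
    then obtain a b a' b' where u: "u = a + b" "a \<in> X" "b \<in> Y"
      and v: "v = a' + b'" "a' \<in> X" "b' \<in> Y" by (auto simp: vsum_def)
    have "a \<in> carrier_vec d" "b \<in> carrier_vec d" "a' \<in> carrier_vec d" "b' \<in> carrier_vec d"
      using cX(1) cY(1) u v by auto
    hence "u + v = (a + a') + (b + b')"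
      unfolding u(1) v(1) by (intro eq_vecI) auto
    thus "u + v \<in> vsum X Y" using cX(3) cY(3) u v unfolding vsum_def by blast
  next
    fix c u assume "u \<in> vsum X Y"
    then obtain a b where u: "u = a + b" "a \<in> X" "b \<in> Y" by (auto simp: vsum_def)
    have "c \<cdot>\<^sub>v u = c \<cdot>\<^sub>v a + c \<cdot>\<^sub>v b"
      using cX(1) cY(1) u by (metis smult_add_distrib_vec)
    thus "c \<cdot>\<^sub>v u \<in> vsum X Y" using cX(4) cY(4) u unfolding vsum_def by blast
  qed
qed

lemma vsum_upper:
  assumes "lin_subspace d X" "lin_subspace d Y"
  shows "X \<subseteq> vsum X Y" "Y \<subseteq> vsum X Y"
proof -
  note cX = lin_subspaceD[OF assms(1)] and cY = lin_subspaceD[OF assms(2)]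
  have "x = x + 0\<^sub>v d" if "x \<in> X" for x using cX(1) that by (metis right_zero_vec)
  moreover have "y = 0\<^sub>v d + y" if "y \<in> Y" for y using cY(1) that by (metis left_zero_vec)
  ultimately show "X \<subseteq> vsum X Y" "Y \<subseteq> vsum X Y"
    using cX(2) cY(2) unfolding vsum_def by blast+
qed

lemma vsum_least:
  "lin_subspace d Z \<Longrightarrow> X \<subseteq> Z \<Longrightarrow> Y \<subseteq> Z \<Longrightarrow> vsum X Y \<subseteq> Z"
  by (auto simp: vsum_def lin_subspace_def subset_iff)

lemma lin_subspace_Int:
  "lin_subspace d X \<Longrightarrow> lin_subspace d Y \<Longrightarrow> lin_subspace d (X \<inter> Y)"
  by (auto simp: lin_subspace_def)

lemma lin_subspace_Inter:
  "A \<noteq> {} \<Longrightarrow> (\<And>X. X \<in> A \<Longrightarrow> lin_subspace d X) \<Longrightarrow> lin_subspace d (\<Inter>A)"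
  unfolding lin_subspace_def by blast

lemma lin_subspace_zero: "lin_subspace d {0\<^sub>v d}"
  by (auto simp: lin_subspace_def)

lemma lin_subspace_carrier: "lin_subspace d (carrier_vec d)"
  by (auto simp: lin_subspace_def)

text \<open>Row reduction without matrices: the vectors of \<open>W\<close> supported on the first \<open>Suc m\<close>
  coordinates exceed those supported on the first \<open>m\<close> by at most one line.\<close>

lemma lin_subspace_induct [consumes 1, case_names zero line]:
  assumes W: "lin_subspace d W"
    and zero: "P {0\<^sub>v d}"
    and step: "\<And>W b. lin_subspace d W \<Longrightarrow> b \<in> carrier_vec d \<Longrightarrow> P W \<Longrightarrow> P (vsum W (line b))"
  shows "P W"
proof -
  define T where "T m = {w \<in> W. \<forall>i. m \<le> i \<longrightarrow> i < d \<longrightarrow> w $ i = 0}" for m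
  note cW = lin_subspaceD[OF W]
  have T: "lin_subspace d (T m)" for m
    using W unfolding lin_subspace_def T_def by (auto simp: subset_iff)
  have T_Suc: "w \<in> T m" if "w $ m = 0" "w \<in> T (Suc m)" for w m
  proof -
    have "w $ i = 0" if "m \<le> i" "i < d" for i
      using that \<open>w $ m = 0\<close> \<open>w \<in> T (Suc m)\<close> by (cases "i = m") (auto simp: T_def)
    thus ?thesis using \<open>w \<in> T (Suc m)\<close> by (auto simp: T_def)
  qed
  have "P (T m)" if "m \<le> d" for m
    using that
  proof (induction m)
    case 0
    have "w = 0\<^sub>v d" if "w \<in> T 0" for w
      using that cW(1) by (intro eq_vecI) (auto simp: T_def)
    hence "T 0 = {0\<^sub>v d}" using lin_subspaceD(2)[OF T] by auto
    thus ?case using zero by simp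
  next
    case (Suc m)
    have sub: "T m \<subseteq> T (Suc m)" by (auto simp: T_def)
    show ?case
    proof (cases "T (Suc m) \<subseteq> T m")
      case True
      hence "T (Suc m) = T m" using sub by blast
      thus ?thesis using Suc by simp
    next
      case False
      then obtain b where b: "b \<in> T (Suc m)" "b \<notin> T m" by blast
      have bm: "b $ m \<noteq> 0"
      proof
        assume "b $ m = 0"
        hence "b \<in> T m" using b(1) by (rule T_Suc)
        thus False using b by simp
      qed
      have bc: "b \<in> carrier_vec d" using b cW(1) by (auto simp: T_def)
      have "T (Suc m) = vsum (T m) (line b)"
      proof
        have "line b \<subseteq> T (Suc m)"
          using lin_subspaceD(4)[OF T] b by (auto simp: line_def)
        thus "vsum (T m) (line b) \<subseteq> T (Suc m)" using vsum_least[OF T sub] by blast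
      next
        show "T (Suc m) \<subseteq> vsum (T m) (line b)"
        proof
          fix w assume w: "w \<in> T (Suc m)"
          define x where "x = w - (w $ m / b $ m) \<cdot>\<^sub>v b"
          have wc: "w \<in> carrier_vec d" using w cW(1) by (auto simp: T_def)
          have xT: "x \<in> T (Suc m)" unfolding x_def
            using lin_subspace_diff[OF T w lin_subspaceD(4)[OF T b(1)]] .
          have "x $ m = 0" using bm bc wc Suc by (simp add: x_def)
          hence "x \<in> T m" using xT by (rule T_Suc)
          moreover have "w = x + (w $ m / b $ m) \<cdot>\<^sub>v b"
            using bc wc by (intro eq_vecI) (auto simp: x_def)
          ultimately show "w \<in> vsum (T m) (line b)" unfolding vsum_def line_def by blast
        qed
      qed
      thus ?thesis using step[OF T bc] Suc by simp
    qed
  qed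
  moreover have "T d = W" by (auto simp: T_def)
  ultimately show ?thesis by (metis order_refl)
qed

section \<open>The modular ortholattice of a positive definite form\<close>

locale definite_form =
  fixes d :: nat and \<Phi> :: "'a::linordered_field vec \<Rightarrow> 'a vec \<Rightarrow> 'a"
  assumes form: "symmetric_bilinear_form d \<Phi>" and definite: "positive_definite d \<Phi>"
begin

abbreviation L where "L \<equiv> subspace_ortholattice d \<Phi>"

abbreviation perp :: "'a vec set \<Rightarrow> 'a vec set" where
  "perp X \<equiv> {y \<in> carrier_vec d. \<forall>x\<in>X. \<Phi> y x = 0}"

lemma form_simps:
  assumes "x \<in> carrier_vec d" "y \<in> carrier_vec d"
  shows "z \<in> carrier_vec d \<Longrightarrow> \<Phi> (x + y) z = \<Phi> x z + \<Phi> y z"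
    "z \<in> carrier_vec d \<Longrightarrow> \<Phi> x (y + z) = \<Phi> x y + \<Phi> x z"
    "\<Phi> (c \<cdot>\<^sub>v x) y = c * \<Phi> x y" "\<Phi> x (c \<cdot>\<^sub>v y) = c * \<Phi> x y" "\<Phi> x y = \<Phi> y x"
  using form assms unfolding symmetric_bilinear_form_def by blast+

lemma form_self_eq_0: "x \<in> carrier_vec d \<Longrightarrow> \<Phi> x x = 0 \<Longrightarrow> x = 0\<^sub>v d"
  using definite unfolding positive_definite_def by (metis less_irrefl)

lemma form_zero:
  assumes "x \<in> carrier_vec d"
  shows "\<Phi> (0\<^sub>v d) x = 0" "\<Phi> x (0\<^sub>v d) = 0"
proof -
  have "0 \<cdot>\<^sub>v x = 0\<^sub>v d" using assms by (intro eq_vecI) auto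
  thus "\<Phi> (0\<^sub>v d) x = 0" "\<Phi> x (0\<^sub>v d) = 0"
    using form_simps(3,4)[OF assms assms, of 0] by simp_all
qed

lemma L_simps [simp]:
  "carrier L = {W. lin_subspace d W}" "le L = (\<subseteq>)" "eq L = (=)" "ocompl L X = perp X"
  by (simp_all add: subspace_ortholattice_def lin_subspace_iff)

lemma lin_subspace_perp:
  assumes "X \<subseteq> carrier_vec d"
  shows "lin_subspace d (perp X)"
  using assms unfolding lin_subspace_def by (auto simp: form_zero form_simps subset_iff)

lemma partial_order_L: "partial_order L"
  by unfold_locales auto

section \<open>Lattice operations as sums and intersections\<close>

lemma lub_vsum:
  assumes "lin_subspace d X" "lin_subspace d Y"
  shows "least L (vsum X Y) (Upper L {X, Y})"
proof (rule least_UpperI)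
  show "vsum X Y \<in> carrier L" using lin_subspace_vsum[OF assms] by simp
  show "Z \<sqsubseteq>\<^bsub>L\<^esub> vsum X Y" if "Z \<in> {X, Y}" for Z
    using that vsum_upper[OF assms] by auto
  show "vsum X Y \<sqsubseteq>\<^bsub>L\<^esub> Z" if "Z \<in> Upper L {X, Y}" for Z
    using that assms vsum_least[of d Z X Y] by (auto simp: Upper_def)
qed (use assms in simp)

text \<open>A join is a chosen least upper bound; uniqueness in a partial order identifies the
  choice with the sum.\<close>

lemma join_L:
  assumes "lin_subspace d X" "lin_subspace d Y"
  shows "X \<squnion>\<^bsub>L\<^esub> Y = vsum X Y"
  unfolding join_def Lattice.sup_def
  by (rule some_equality)
    (use lub_vsum[OF assms] partial_order.least_unique[OF partial_order_L] in blast)+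

lemma glb_Inter:
  assumes "A \<noteq> {}" "A \<subseteq> carrier L"
  shows "greatest L (\<Inter>A) (Lower L A)"
proof (rule greatest_LowerI)
  show "\<Inter>A \<in> carrier L" using lin_subspace_Inter[OF assms(1)] assms(2) by auto
  show "\<Inter>A \<sqsubseteq>\<^bsub>L\<^esub> Z" if "Z \<in> A" for Z
    using that by auto
  show "Z \<sqsubseteq>\<^bsub>L\<^esub> \<Inter>A" if "Z \<in> Lower L A" for Z
    using that assms by (auto simp: Lower_def)
qed (rule assms(2))

text \<open>Stated for families because the frame law takes the infimum of all axes at once.
  Nonemptiness matters: the empty intersection is the whole type, not the space.\<close>

lemma inf_L:
  assumes "A \<noteq> {}" "A \<subseteq> carrier L"
  shows "\<Sqinter>\<^bsub>L\<^esub> A = \<Inter>A"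
  unfolding Lattice.inf_def
  by (rule some_equality)
    (use glb_Inter[OF assms] partial_order.greatest_unique[OF partial_order_L] in blast)+

lemma meet_L: "lin_subspace d X \<Longrightarrow> lin_subspace d Y \<Longrightarrow> X \<sqinter>\<^bsub>L\<^esub> Y = X \<inter> Y"
  unfolding meet_def by (subst inf_L) auto

lemma bounded_lattice_L: "bounded_lattice L"
proof -
  interpret partial_order L by (rule partial_order_L)
  show ?thesis
  proof
    fix X Y assume "X \<in> carrier L" "Y \<in> carrier L"
    thus "\<exists>s. least L s (Upper L {X, Y})" "\<exists>s. greatest L s (Lower L {X, Y})"
      using lub_vsum[of X Y] glb_Inter[of "{X, Y}"] by auto
  next
    show "\<exists>x. least L x (carrier L)"
      by (rule exI[of _ "{0\<^sub>v d}"]) (auto simp: least_def lin_subspace_zero lin_subspaceD)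
    show "\<exists>x. greatest L x (carrier L)"
      by (rule exI[of _ "carrier_vec d"])
        (auto simp: greatest_def lin_subspace_carrier lin_subspaceD)
  qed
qed

lemma bottom_L: "\<bottom>\<^bsub>L\<^esub> = {0\<^sub>v d}"
  using bounded_lattice.bottom_eq[OF bounded_lattice_L, of "{0\<^sub>v d}"] lin_subspace_zero
  by (auto simp: lin_subspaceD)

lemma top_L: "\<top>\<^bsub>L\<^esub> = carrier_vec d"
  using bounded_lattice.top_eq[OF bounded_lattice_L, of "carrier_vec d"] lin_subspace_carrier
  by (auto dest: lin_subspaceD)

text \<open>Gram-Schmidt, phrased as existence of an orthogonal projection and run along the
  induction that adds one line at a time. The only division is by \<open>\<Phi> u u\<close>, so any
  ordered field will do, without square roots.\<close>

lemma vsum_perp: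
  assumes "lin_subspace d W"
  shows "vsum W (perp W) = carrier_vec d"
proof -
  have "\<forall>v\<in>carrier_vec d. \<exists>w\<in>W. v - w \<in> perp W"
    using assms
  proof (induction rule: lin_subspace_induct)
    case zero
    show ?case using form_simps(5) form_zero by auto
  next
    case (line W b)
    note cW = lin_subspaceD[OF line(1)]
    obtain w0 where w0: "w0 \<in> W" "b - w0 \<in> perp W" using line by blast
    \<comment> \<open>The component of the new vector orthogonal to \<open>W\<close>; it vanishes
      exactly when \<open>b\<close> already lies in \<open>W\<close>.\<close>
    define u where "u = b - w0"
    have uc: "u \<in> carrier_vec d" using w0 by (auto simp: u_def)
    have b: "b = w0 + u" using line(2) cW(1)[OF w0(1)] by (intro eq_vecI) (auto simp: u_def)
    have uW: "\<Phi> u x = 0" if "x \<in> W" for x using w0 that by (simp add: u_def)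
    show ?case
    proof
      fix v :: "'a vec" assume v: "v \<in> carrier_vec d"
      then obtain w where w: "w \<in> W" "v - w \<in> perp W" using line by blast
      define r where "r = v - w"
      have rc: "r \<in> carrier_vec d" and rW: "\<And>x. x \<in> W \<Longrightarrow> \<Phi> r x = 0"
        using w by (auto simp: r_def)
      \<comment> \<open>For \<open>u = 0\<close> the line adds nothing and any coefficient works; 0
        is taken.\<close>
      define c where "c = (if u = 0\<^sub>v d then 0 else \<Phi> r u / \<Phi> u u)"
      \<comment> \<open>This is \<open>w + c u\<close>, the projection of \<open>v\<close> to the
        enlarged space, arranged as an element of \<open>W\<close> plus a multiple of
        \<open>b\<close>.\<close>
      define p where "p = (w + (- c) \<cdot>\<^sub>v w0) + c \<cdot>\<^sub>v b"
      have wc: "w \<in> carrier_vec d" "w0 \<in> carrier_vec d" using w w0 cW by auto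
      have pW: "p \<in> vsum W (line b)"
      proof -
        have "w + (- c) \<cdot>\<^sub>v w0 \<in> W" using cW(3,4) w(1) w0(1) by simp
        thus ?thesis unfolding p_def vsum_def line_def by blast
      qed
      have vp: "v - p = r + (- c) \<cdot>\<^sub>v u"
        using v wc uc unfolding p_def r_def b by (intro eq_vecI) (simp_all add: algebra_simps)
      have ru: "\<Phi> r u = c * \<Phi> u u"
      proof (cases "u = 0\<^sub>v d")
        case True
        thus ?thesis using form_zero(2)[OF rc] by (simp add: c_def)
      next
        case False
        thus ?thesis using form_self_eq_0[OF uc] by (auto simp: c_def)
      qed
      have "\<Phi> (v - p) x = 0" if xb: "x \<in> vsum W (line b)" for x
      proof -
        obtain y e where x: "x = y + e \<cdot>\<^sub>v b" "y \<in> W"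
          using xb unfolding vsum_def line_def by blast
        have yc: "y \<in> carrier_vec d" using x cW by auto
        have "\<Phi> (v - p) y = 0"
          using rc uc yc rW[OF x(2)] uW[OF x(2)] by (simp add: vp form_simps(1,3))
        moreover have "\<Phi> (v - p) b = 0"
          using rc uc wc rW[OF w0(1)] uW[OF w0(1)] ru
          by (simp add: vp b form_simps(1-4))
        ultimately show ?thesis
          using rc uc yc line(2) by (simp add: x form_simps(2,4) vp)
      qed
      moreover have "v - p \<in> carrier_vec d" using rc uc by (simp add: vp)
      ultimately show "\<exists>w\<in>vsum W (line b). v - w \<in> perp (vsum W (line b))"
        using pW by blast
    qed
  qed
  moreover have "lin_subspace d (perp W)"
    using assms by (intro lin_subspace_perp) (auto dest: lin_subspaceD(1))
  ultimately show ?thesis using assms by (auto simp: mem_vsum)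
qed

lemma Int_perp: "lin_subspace d W \<Longrightarrow> W \<inter> perp W = {0\<^sub>v d}"
  using form_self_eq_0 form_zero by (auto dest: lin_subspaceD(1,2))

text \<open>Follows from the orthogonal decomposition instead of a dimension count: the component of
  \<open>y\<close> in \<open>perp W\<close> is orthogonal to itself, hence zero.\<close>

lemma perp_perp:
  assumes W: "lin_subspace d W"
  shows "perp (perp W) = W"
proof
  show "W \<subseteq> perp (perp W)"
    using lin_subspaceD(1)[OF W] form_simps(5) by auto
  show "perp (perp W) \<subseteq> W"
  proof
    fix y assume y: "y \<in> perp (perp W)"
    then obtain w u where wu: "y = w + u" "w \<in> W" "u \<in> perp W"
      using vsum_perp[OF W] unfolding vsum_def by blast
    have c: "w \<in> carrier_vec d" "u \<in> carrier_vec d" using wu lin_subspaceD(1)[OF W] by auto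
    have "\<Phi> y u = 0" using y wu by blast
    moreover have "\<Phi> w u = 0" using wu c form_simps(5) by auto
    ultimately have "\<Phi> u u = 0" using c by (simp add: wu form_simps(1))
    hence "u = 0\<^sub>v d" using form_self_eq_0 c by blast
    thus "y \<in> W" using wu c by simp
  qed
qed

lemma modular_ortholattice_L: "modular_ortholattice L"
proof -
  interpret bounded_lattice L by (rule bounded_lattice_L)
  show ?thesis
  proof
    fix X Y Z assume "X \<in> carrier L" "Y \<in> carrier L" "Z \<in> carrier L" "X \<sqsubseteq>\<^bsub>L\<^esub> Z"
    hence s: "lin_subspace d X" "lin_subspace d Y" "lin_subspace d Z" "X \<subseteq> Z" by auto
    have "v \<in> vsum X (Y \<inter> Z)" if v: "v \<in> vsum X Y" "v \<in> Z" for v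
    proof -
      obtain x where x: "v \<in> carrier_vec d" "x \<in> X" "v - x \<in> Y"
        using v s by (auto simp: mem_vsum)
      \<comment> \<open>Here \<open>X \<subseteq> Z\<close> enters: the remainder stays in
        \<open>Z\<close> because \<open>x\<close> does.\<close>
      moreover have "v - x \<in> Z" using lin_subspace_diff[OF s(3)] s(4) x v by blast
      ultimately show ?thesis using s by (auto simp: mem_vsum[OF s(1) lin_subspace_Int[OF s(2,3)]])
    qed
    moreover have "vsum X (Y \<inter> Z) \<subseteq> vsum X Y" by (auto simp: vsum_def)
    moreover have "vsum X (Y \<inter> Z) \<subseteq> Z" using s by (intro vsum_least) auto
    ultimately show "X \<squnion>\<^bsub>L\<^esub> (Y \<sqinter>\<^bsub>L\<^esub> Z) = (X \<squnion>\<^bsub>L\<^esub> Y) \<sqinter>\<^bsub>L\<^esub> Z"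
      using s by (auto simp: join_L meet_L lin_subspace_vsum lin_subspace_Int)
  next
    fix X assume "X \<in> carrier L"
    hence X: "lin_subspace d X" by simp
    hence P: "lin_subspace d (perp X)" by (intro lin_subspace_perp) (auto dest: lin_subspaceD(1))
    show "ocompl L X \<in> carrier L" using P by simp
    show "ocompl L (ocompl L X) = X" using perp_perp[OF X] by simp
    show "X \<squnion>\<^bsub>L\<^esub> ocompl L X = \<top>\<^bsub>L\<^esub>" using X P by (simp add: join_L vsum_perp top_L)
    show "X \<sqinter>\<^bsub>L\<^esub> ocompl L X = \<bottom>\<^bsub>L\<^esub>" using X P by (simp add: meet_L Int_perp bottom_L)
  next
    fix X Y assume "X \<sqsubseteq>\<^bsub>L\<^esub> Y"
    thus "ocompl L Y \<sqsubseteq>\<^bsub>L\<^esub> ocompl L X" by auto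
  qed
qed

end

section \<open>A two-generated matrix ring\<close>

text \<open>The closure hypotheses are those that graphs provide: differences instead of sums, and
  inverses where they exist instead of rational scaling.\<close>

lemma rat_mat_subring_full:
  fixes R :: "rat mat set"
  assumes sub: "R \<subseteq> carrier_mat n n"
    and one: "1\<^sub>m n \<in> R"
    and diff: "\<And>M N. M \<in> R \<Longrightarrow> N \<in> R \<Longrightarrow> M - N \<in> R"
    and mult: "\<And>M N. M \<in> R \<Longrightarrow> N \<in> R \<Longrightarrow> M * N \<in> R"
    and inv: "\<And>M N. M \<in> R \<Longrightarrow> N \<in> carrier_mat n n \<Longrightarrow> M * N = 1\<^sub>m n \<Longrightarrow> N * M = 1\<^sub>m n \<Longrightarrow> N \<in> R"
    and diag: "mat n n (\<lambda>(i, j). if i = j then of_nat (i + 1) else 0) \<in> R"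
    and ones: "mat n n (\<lambda>_. 1) \<in> R"
  shows "R = carrier_mat n n"
proof -
  define \<delta> :: "(nat \<Rightarrow> rat) \<Rightarrow> rat mat" where "\<delta> f = mat n n (\<lambda>(i, j). if i = j then f i else 0)" for f
  have \<delta>_carrier [simp]: "\<delta> f \<in> carrier_mat n n" for f by (simp add: \<delta>_def)
  have \<delta>_mult_left: "\<delta> f * M = mat n n (\<lambda>(i, j). f i * M $$ (i, j))"
    if "M \<in> carrier_mat n n" for f M
    using that by (intro eq_matI) (auto simp: \<delta>_def scalar_prod_def if_distrib[of "\<lambda>x. x * _"] sum.delta cong: if_cong)
  have \<delta>_mult_right: "M * \<delta> f = mat n n (\<lambda>(i, j). M $$ (i, j) * f j)"
    if "M \<in> carrier_mat n n" for f M
    using that by (intro eq_matI) (auto simp: \<delta>_def scalar_prod_def if_distrib[of "\<lambda>x. _ * x"] sum.delta cong: if_cong)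
  have \<delta>_mult: "\<delta> f * \<delta> g = \<delta> (\<lambda>i. f i * g i)" for f g
    by (subst \<delta>_mult_left) (auto simp: \<delta>_def intro!: eq_matI)
  have \<delta>_diff: "\<delta> f - \<delta> g = \<delta> (\<lambda>i. f i - g i)" for f g
    by (auto simp: \<delta>_def intro!: eq_matI)
  have \<delta>_one: "\<delta> (\<lambda>_. 1) = 1\<^sub>m n"
    by (auto simp: \<delta>_def intro!: eq_matI)
  have zero: "\<delta> (\<lambda>_. 0) \<in> R"
    using diff[OF one one] \<delta>_diff[of "\<lambda>_. 1" "\<lambda>_. 1"] by (simp add: \<delta>_one)
  have add: "M + N \<in> R" if "M \<in> R" "N \<in> R" for M N
  proof -
    \<comment> \<open>Sums are recovered from differences by subtracting the negative.\<close>
    have "M + N = M - (\<delta> (\<lambda>_. 0) - N)"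
      using that sub by (intro eq_matI) (auto simp: \<delta>_def)
    thus ?thesis using diff zero that by simp
  qed
  have nat: "\<delta> (\<lambda>_. of_nat m) \<in> R" for m
  proof (induction m)
    case (Suc m)
    have "\<delta> (\<lambda>_. of_nat (Suc m)) = \<delta> (\<lambda>_. of_nat m) + 1\<^sub>m n"
      by (auto simp: \<delta>_def intro!: eq_matI)
    thus ?case using add[OF Suc one] by simp
  qed (use zero in simp)
  have int: "\<delta> (\<lambda>_. of_int a) \<in> R" for a
  proof (cases a)
    case (nonneg m)
    thus ?thesis using nat by simp
  next
    case (neg m)
    thus ?thesis using diff[OF zero nat[of "Suc m"]] by (simp add: \<delta>_diff)
  qed
  have const: "\<delta> (\<lambda>_. q) \<in> R" for q
  proof (cases q)
    case (Fract a b)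
    \<comment> \<open>The denominator is nonzero, so its scalar matrix is invertible and closure
      under inverses applies.\<close>
    have "\<delta> (\<lambda>_. inverse (of_int b)) \<in> R"
      by (rule inv[OF int[of b]]) (use Fract in \<open>auto simp: \<delta>_mult \<delta>_one\<close>)
    from mult[OF int[of a] this] show ?thesis using Fract by (auto simp: \<delta>_mult Fract_of_int_quotient divide_inverse)
  qed
  have id: "\<delta> (\<lambda>i. of_nat (i + 1)) \<in> R"
    using diag unfolding \<delta>_def .
  \<comment> \<open>The numerator of the Lagrange polynomial for row \<open>i\<close>. Rows are
    counted from 0 and row \<open>l\<close> of the diagonal matrix carries the entry
    \<open>l + 1\<close>, so these are the interpolation nodes.\<close>
  define p :: "nat \<Rightarrow> nat \<Rightarrow> rat" where "p i = (\<lambda>a. \<Prod>l\<in>{..<n} - {i}. of_nat (a + 1) - of_nat (l + 1))" for i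
  have "\<delta> (\<lambda>a. \<Prod>l\<in>F. of_nat (a + 1) - of_nat (l + 1)) \<in> R" if "finite F" for F :: "nat set"
    using that
  proof induction
    case (insert l F)
    have "\<delta> (\<lambda>a. of_nat (a + 1) - of_nat (l + 1)) \<in> R"
      using diff[OF id const[of "of_nat (l + 1)"]] by (simp add: \<delta>_diff)
    from mult[OF this insert(3)] show ?case using insert(1,2) by (simp add: \<delta>_mult)
  qed (use const[of 1] in simp)
  hence p: "\<delta> (p i) \<in> R" for i by (simp add: p_def)
  have p_zero: "p i a = 0" if "a < n" "a \<noteq> i" for i a
    using that unfolding p_def by (intro prod_zero) auto
  have p_nz: "p i i \<noteq> 0" for i by (simp add: p_def)
  \<comment> \<open>Multiplying the all-ones matrix by \<open>\<delta> (p i)\<close> on the left and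
    \<open>\<delta> (p j)\<close> on the right leaves the single entry \<open>p i i * p j j\<close>;
    the scalar factor normalizes it to \<open>c\<close>.\<close>
  have unit: "mat n n (\<lambda>(a, b). if a = i \<and> b = j then c else 0) \<in> R" if "i < n" "j < n" for i j c
  proof -
    have "mat n n (\<lambda>(a, b). if a = i \<and> b = j then c else 0)
        = \<delta> (\<lambda>_. c / (p i i * p j j)) * (\<delta> (p i) * (mat n n (\<lambda>_. 1) * \<delta> (p j)))"
      using that p_zero p_nz
      by (subst \<delta>_mult_right, simp, subst \<delta>_mult_left, simp, subst \<delta>_mult_left, simp)
        (auto intro!: eq_matI)
    thus ?thesis using mult const p ones by simp
  qed
  have "M \<in> R" if M: "M \<in> carrier_mat n n" for M
  proof -
    \<comment> \<open>The entries of \<open>M\<close> are switched on one at a time in row-major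
      order; position \<open>m\<close> is row \<open>m div n\<close>, column
      \<open>m mod n\<close>.\<close>
    have "mat n n (\<lambda>(a, b). if a * n + b < m then M $$ (a, b) else 0) \<in> R" if "m \<le> n * n" for m
      using that
    proof (induction m)
      case 0
      have "mat n n (\<lambda>(a, b). if a * n + b < 0 then M $$ (a, b) else 0) = \<delta> (\<lambda>_. 0)"
        by (auto simp: \<delta>_def intro!: eq_matI)
      thus ?case using zero by (rule ssubst)
    next
      case (Suc m)
      have n: "0 < n" using Suc by (cases n) auto
      have md: "m div n < n" "m mod n < n" using Suc n by (auto simp: less_mult_imp_div_less)
      have eq: "a * n + b = m \<longleftrightarrow> a = m div n \<and> b = m mod n" if "b < n" for a b
        using that by auto
      have "mat n n (\<lambda>(a, b). if a * n + b < Suc m then M $$ (a, b) else 0)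
          = mat n n (\<lambda>(a, b). if a * n + b < m then M $$ (a, b) else 0)
          + mat n n (\<lambda>(a, b). if a = m div n \<and> b = m mod n then M $$ (m div n, m mod n) else 0)"
        by (intro eq_matI) (auto simp: less_Suc_eq eq)
      thus ?case using add[OF Suc(1) unit[OF md]] Suc by simp
    qed
    from this[of "n * n"] have "mat n n (\<lambda>(a, b). if a * n + b < n * n then M $$ (a, b) else 0) \<in> R" by simp
    also have "mat n n (\<lambda>(a, b). if a * n + b < n * n then M $$ (a, b) else 0) = M"
    proof (intro eq_matI)
      fix a b assume "a < dim_row M" "b < dim_col M"
      hence ab: "a < n" "b < n" using M by auto
      have "a * n + b < Suc a * n" using ab by simp
      also have "\<dots> \<le> n * n" using ab by (intro mult_right_mono) auto
      finally show "mat n n (\<lambda>(a, b). if a * n + b < n * n then M $$ (a, b) else 0) $$ (a, b) = M $$ (a, b)"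
        using ab by simp
    qed (use M in auto)
    finally show ?thesis .
  qed
  thus ?thesis using sub by blast
qed

section \<open>Graphs of matrices in three blocks\<close>

text \<open>Blocks are counted from 1, coordinates inside a block from 0.\<close>

definition part :: "nat \<Rightarrow> nat \<Rightarrow> rat vec \<Rightarrow> rat vec" where
  "part n i v = vec n (\<lambda>t. v $ (t + (i - 1) * n))"

text \<open>Allowing a set of blocks covers the bottom element, the frame elements and the
  coordinate planes spanned by two of them at once.\<close>

definition axes :: "nat \<Rightarrow> nat set \<Rightarrow> rat vec set" where
  "axes n S = {v \<in> carrier_vec (3 * n). \<forall>k\<in>{1..3} - S. part n k v = 0\<^sub>v n}"

text \<open>The sign makes \<open>graph n i j (1\<^sub>m n)\<close> the frame element with indices \<open>i\<close>, \<open>j\<close>.\<close>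

definition graph :: "nat \<Rightarrow> nat \<Rightarrow> nat \<Rightarrow> rat mat \<Rightarrow> rat vec set" where
  "graph n i j M = {v \<in> axes n {i, j}. part n j v = - (M *\<^sub>v part n i v)}"

text \<open>The third index names the block not in play, so a subspace is described by one condition
  per block whatever the order of the indices.\<close>

definition triple :: "nat \<Rightarrow> nat \<Rightarrow> nat \<Rightarrow> bool" where
  "triple i j k \<longleftrightarrow> i \<in> {1..3} \<and> j \<in> {1..3} \<and> k \<in> {1..3} \<and> i \<noteq> j \<and> j \<noteq> k \<and> i \<noteq> k"

lemma triple_perm:
  assumes "triple i j k"
  shows "triple j i k" "triple i k j" "triple k j i" "triple j k i" "triple k i j"
  using assms by (auto simp: triple_def)

lemma triple_mem: "triple i j k \<Longrightarrow> i \<in> {1..3} \<and> j \<in> {1..3} \<and> k \<in> {1..3}"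
  by (simp add: triple_def)

lemma triple_set:
  assumes "triple i j k"
  shows "{1..3} = {i, j, k}" "{1..3} - {i} = {j, k}" "{1..3} - {i, j} = {k}"
proof -
  have d: "i \<noteq> j" "j \<noteq> k" "i \<noteq> k" and s: "{i, j, k} \<subseteq> {1..3}"
    using assms by (simp_all add: triple_def)
  have "card {i, j, k} = card {1..3::nat}" using d by simp
  thus e: "{1..3} = {i, j, k}" using card_subset_eq[OF _ s] by simp
  show "{1..3} - {i} = {j, k}" "{1..3} - {i, j} = {k}"
    unfolding e using d by blast+
qed

lemma triple_123: "triple 1 2 3" "triple 1 3 2"
  by (simp_all add: triple_def)

lemma ex_triple:
  assumes "i \<in> {1..3}" "j \<in> {1..3}" "i \<noteq> j"
  obtains k where "triple i j k"
proof -
  \<comment> \<open>The three indices sum to 6.\<close>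
  have "triple i j (6 - i - j)"
    using assms unfolding triple_def atLeastAtMost_iff by presburger
  thus thesis by (rule that)
qed

section \<open>Reading vectors block by block\<close>

lemma part_carrier [simp]: "part n i v \<in> carrier_vec n"
  by (simp add: part_def)

lemma dim_part [simp]: "dim_vec (part n i v) = n"
  by (simp add: part_def)

lemma part_less:
  fixes i n t :: nat
  assumes t: "t < n" "i \<in> {1..3}"
  shows "t + (i - 1) * n < 3 * n"
proof -
  have "t + (i - 1) * n < i * n" using t by (cases i) auto
  also have "\<dots> \<le> 3 * n" using t by (intro mult_right_mono) auto
  finally show ?thesis .
qed

lemma part_add:
  assumes "u \<in> carrier_vec (3 * n)" "v \<in> carrier_vec (3 * n)" "i \<in> {1..3}"
  shows "part n i (u + v) = part n i u + part n i v"
  using assms part_less[OF _ assms(3)] by (intro eq_vecI) (auto simp: part_def)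

lemma part_diff:
  assumes "u \<in> carrier_vec (3 * n)" "v \<in> carrier_vec (3 * n)" "i \<in> {1..3}"
  shows "part n i (u - v) = part n i u - part n i v"
  using assms part_less[OF _ assms(3)] by (intro eq_vecI) (auto simp: part_def)

lemma part_smult:
  assumes "v \<in> carrier_vec (3 * n)" "i \<in> {1..3}"
  shows "part n i (c \<cdot>\<^sub>v v) = c \<cdot>\<^sub>v part n i v"
  using assms part_less[OF _ assms(2)] by (intro eq_vecI) (auto simp: part_def)

lemma part_zero: "i \<in> {1..3} \<Longrightarrow> part n i (0\<^sub>v (3 * n)) = 0\<^sub>v n"
  using part_less[of _ n i] by (intro eq_vecI) (auto simp: part_def)

lemma vec_simps:
  fixes x y :: "'a::ab_group_add vec"
  assumes "x \<in> carrier_vec n"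
  shows "x - x = 0\<^sub>v n" "x - 0\<^sub>v n = x" "0\<^sub>v n - x = - x" "- (- x) = x" "- (0\<^sub>v n) = (0\<^sub>v n :: 'a vec)"
    "0\<^sub>v n = - x \<longleftrightarrow> x = 0\<^sub>v n" "- x = 0\<^sub>v n \<longleftrightarrow> x = 0\<^sub>v n"
    "y \<in> carrier_vec n \<Longrightarrow> x - y = 0\<^sub>v n \<longleftrightarrow> x = y"
  using assms by (auto simp: vec_eq_iff)

lemma block_index:
  fixes n s :: nat
  assumes "s < 3 * n"
  shows "s mod n < n" "s div n + 1 \<in> {1..3}" "s mod n + (s div n + 1 - 1) * n = s"
proof -
  have "0 < n" using assms by (cases n) auto
  thus "s mod n < n" "s mod n + (s div n + 1 - 1) * n = s" by auto
  have "s div n < 3" using assms by (simp add: less_mult_imp_div_less)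
  thus "s div n + 1 \<in> {1..3}" by auto
qed

lemma part_eqI:
  assumes "u \<in> carrier_vec (3 * n)" "v \<in> carrier_vec (3 * n)"
    and "\<And>i. i \<in> {1..3} \<Longrightarrow> part n i u = part n i v"
  shows "u = v"
proof (rule eq_vecI)
  fix s assume "s < dim_vec v"
  hence s: "s < 3 * n" using assms by simp
  note b = block_index[OF s]
  have "part n (s div n + 1) u $ (s mod n) = part n (s div n + 1) v $ (s mod n)"
    using assms(3)[OF b(2)] by simp
  thus "u $ s = v $ s" using b by (simp add: part_def)
qed (use assms in simp)

text \<open>Supplies the witnesses for sums of subspaces: the intermediate vector is prescribed
  block by block.\<close>

lemma ex_parts:
  assumes T: "triple i j k"
    and c: "x \<in> carrier_vec n" "y \<in> carrier_vec n" "z \<in> carrier_vec n"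
  obtains v where "v \<in> carrier_vec (3 * n)" "part n i v = x" "part n j v = y" "part n k v = z"
proof -
  \<comment> \<open>The default value \<open>x\<close> serves index \<open>i\<close>.\<close>
  define f where "f = (\<lambda>_. x)(j := y, k := z)"
  define v where "v = vec (3 * n) (\<lambda>s. f (s div n + 1) $ (s mod n))"
  have fc: "f l \<in> carrier_vec n" for l using c by (simp add: f_def)
  have p: "part n l v = f l" if l: "l \<in> {1..3}" for l
  proof (rule eq_vecI)
    fix t assume "t < dim_vec (f l)"
    hence t: "t < n" using fc[of l] by simp
    have "(t + (l - 1) * n) div n + 1 = l" "(t + (l - 1) * n) mod n = t" using t l by auto
    thus "part n l v $ t = f l $ t" using t part_less[OF t l] by (simp add: part_def v_def)
  qed (use fc[of l] in \<open>simp add: part_def\<close>)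
  have "i \<in> {1..3}" "j \<in> {1..3}" "k \<in> {1..3}" "i \<noteq> j" "j \<noteq> k" "i \<noteq> k"
    using T by (simp_all add: triple_def)
  thus thesis using that[of v] p by (simp add: v_def f_def)
qed

lemma triple_eqI:
  assumes "triple i j k" "u \<in> carrier_vec (3 * n)" "v \<in> carrier_vec (3 * n)"
    "part n i u = part n i v" "part n j u = part n j v" "part n k u = part n k v"
  shows "u = v"
proof (rule part_eqI)
  fix l :: nat assume "l \<in> {1..3}"
  hence "l \<in> {i, j, k}" unfolding triple_set(1)[OF assms(1)] .
  thus "part n l u = part n l v" using assms(4-6) by blast
qed (use assms in simp_all)

lemma mem_axes:
  assumes "triple i j k"
  shows "v \<in> axes n {i} \<longleftrightarrow> v \<in> carrier_vec (3 * n) \<and> part n j v = 0\<^sub>v n \<and> part n k v = 0\<^sub>v n"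
    and "v \<in> axes n {i, j} \<longleftrightarrow> v \<in> carrier_vec (3 * n) \<and> part n k v = 0\<^sub>v n"
  unfolding axes_def triple_set(2,3)[OF assms] by blast+

lemma mem_graph:
  assumes "triple i j k"
  shows "v \<in> graph n i j M \<longleftrightarrow>
    v \<in> carrier_vec (3 * n) \<and> part n k v = 0\<^sub>v n \<and> part n j v = - (M *\<^sub>v part n i v)"
  using mem_axes(2)[OF assms] by (auto simp: graph_def)

lemma axes_empty: "axes n {} = {0\<^sub>v (3 * n)}"
proof -
  have "v = 0\<^sub>v (3 * n)" if "v \<in> axes n {}" for v
    by (rule part_eqI) (use that in \<open>auto simp: axes_def part_zero\<close>)
  thus ?thesis by (auto simp: axes_def part_zero)
qed

lemma lin_subspace_axes: "lin_subspace (3 * n) (axes n S)"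
  unfolding lin_subspace_def by (auto simp: axes_def part_zero part_add part_smult)

lemma lin_subspace_graph:
  assumes "M \<in> carrier_mat n n" "i \<in> {1..3}" "j \<in> {1..3}"
  shows "lin_subspace (3 * n) (graph n i j M)"
proof -
  note A = lin_subspaceD[OF lin_subspace_axes]
  show ?thesis unfolding lin_subspace_def
  proof (intro conjI ballI allI)
    show "graph n i j M \<subseteq> carrier_vec (3 * n)" by (auto simp: graph_def axes_def)
    show "0\<^sub>v (3 * n) \<in> graph n i j M"
      using assms A(2) by (auto simp: graph_def part_zero)
  next
    fix u v assume uv: "u \<in> graph n i j M" "v \<in> graph n i j M"
    hence c: "u \<in> carrier_vec (3 * n)" "v \<in> carrier_vec (3 * n)" by (auto simp: graph_def axes_def)
    have "- (M *\<^sub>v part n i u) + - (M *\<^sub>v part n i v) = - (M *\<^sub>v part n i u + M *\<^sub>v part n i v)"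
      using assms by (intro eq_vecI) auto
    thus "u + v \<in> graph n i j M"
      using uv assms A(3) c
      by (auto simp: graph_def part_add mult_add_distrib_mat_vec[of M n n])
  next
    fix c v assume v: "v \<in> graph n i j M"
    hence vc: "v \<in> carrier_vec (3 * n)" by (auto simp: graph_def axes_def)
    have "c \<cdot>\<^sub>v - (M *\<^sub>v part n i v) = - (c \<cdot>\<^sub>v (M *\<^sub>v part n i v))"
      using assms by (intro eq_vecI) auto
    thus "c \<cdot>\<^sub>v v \<in> graph n i j M"
      using v assms A(4) vc
      by (auto simp: graph_def part_smult mult_mat_vec[of M n n])
  qed
qed

lemma axes_one_one:
  assumes T: "triple i j k"
  shows "vsum (axes n {i}) (axes n {j}) = axes n {i, j}"
proof (rule Set.set_eqI)
  fix v :: "rat vec"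
  note m = triple_mem[OF T]
  show "v \<in> vsum (axes n {i}) (axes n {j}) \<longleftrightarrow> v \<in> axes n {i, j}"
  proof
    assume "v \<in> vsum (axes n {i}) (axes n {j})"
    then obtain x where x: "v \<in> carrier_vec (3 * n)" "x \<in> axes n {i}" "v - x \<in> axes n {j}"
      using mem_vsum[OF lin_subspace_axes lin_subspace_axes] by blast
    thus "v \<in> axes n {i, j}"
      using m by (auto simp: mem_axes[OF T] mem_axes(1)[OF triple_perm(1)[OF T]] part_diff)
  next
    assume v: "v \<in> axes n {i, j}"
    obtain x where x: "x \<in> carrier_vec (3 * n)" "part n i x = part n i v"
      "part n j x = 0\<^sub>v n" "part n k x = 0\<^sub>v n"
      using ex_parts[OF T part_carrier zero_carrier_vec zero_carrier_vec] by metis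
    have "x \<in> axes n {i}" "v - x \<in> axes n {j}" "v \<in> carrier_vec (3 * n)"
      using x v m by (auto simp: mem_axes[OF T] mem_axes(1)[OF triple_perm(1)[OF T]] part_diff)
    thus "v \<in> vsum (axes n {i}) (axes n {j})"
      using mem_vsum[OF lin_subspace_axes lin_subspace_axes] by blast
  qed
qed

text \<open>Adding the axis of block \<open>k\<close> frees that part, which turns the graph into a
  cylinder: only the relation between parts \<open>i\<close> and \<open>j\<close> survives.\<close>

lemma mem_vsum_graph_axes:
  assumes "triple i j k" "M \<in> carrier_mat n n"
  shows "v \<in> vsum (graph n i j M) (axes n {k}) \<longleftrightarrow>
    v \<in> carrier_vec (3 * n) \<and> part n j v = - (M *\<^sub>v part n i v)"
proof -
  note T = assms(1) and M = assms(2)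
  note m = triple_mem[OF T]
  have s: "lin_subspace (3 * n) (graph n i j M)" using lin_subspace_graph[OF M] m by blast
  note g = mem_graph[OF T] and x = mem_axes(1)[OF triple_perm(5)[OF T]]
  show ?thesis
  proof
    assume "v \<in> vsum (graph n i j M) (axes n {k})"
    then obtain a where v: "v \<in> carrier_vec (3 * n)" and a: "a \<in> graph n i j M" "v - a \<in> axes n {k}"
      using mem_vsum[OF s lin_subspace_axes] by blast
    have "a \<in> carrier_vec (3 * n)" using a by (simp add: g)
    hence "part n i v = part n i a" "part n j v = part n j a"
      using m v a(2) by (simp_all add: x part_diff vec_simps[OF part_carrier])
    thus "v \<in> carrier_vec (3 * n) \<and> part n j v = - (M *\<^sub>v part n i v)"
      using v a by (simp add: g)
  next
    assume v: "v \<in> carrier_vec (3 * n) \<and> part n j v = - (M *\<^sub>v part n i v)"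
    obtain a where a: "a \<in> carrier_vec (3 * n)" "part n i a = part n i v"
      "part n j a = part n j v" "part n k a = 0\<^sub>v n"
      using ex_parts[OF T part_carrier part_carrier zero_carrier_vec] by metis
    have "v - a \<in> axes n {k}"
      using a v[THEN conjunct1] m by (simp add: x part_diff vec_simps[OF part_carrier])
    moreover have "a \<in> graph n i j M" using a v by (simp add: g)
    ultimately show "v \<in> vsum (graph n i j M) (axes n {k})"
      using mem_vsum[OF s lin_subspace_axes] v by blast
  qed
qed

text \<open>Von Staudt multiplication. In blocks \<open>i, j, k\<close> the summands are (x, -Mx, 0)
  and (0, y, -Ny); a vanishing middle part forces y = Mx, and the sum is (x, 0, -NMx). The two signs
  of the middle part cancel, leaving the one that \<open>graph\<close> expects.\<close>

lemma graph_comp: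
  assumes T: "triple i j k" and M: "M \<in> carrier_mat n n" and N: "N \<in> carrier_mat n n"
  shows "vsum (graph n i j M) (graph n j k N) \<inter> axes n {i, k} = graph n i k (N * M)"
proof (rule Set.set_eqI)
  fix v :: "rat vec"
  note m = triple_mem[OF T]
  have s: "lin_subspace (3 * n) (graph n i j M)" "lin_subspace (3 * n) (graph n j k N)"
    using M N m by (simp_all add: lin_subspace_graph)
  note g1 = mem_graph[OF T] and g2 = mem_graph[OF triple_perm(4)[OF T]]
    and g3 = mem_graph[OF triple_perm(2)[OF T]] and x = mem_axes(2)[OF triple_perm(2)[OF T]]
  have c: "M *\<^sub>v part n i w \<in> carrier_vec n" for w
    using M by (rule mult_mat_vec_carrier) simp
  show "v \<in> vsum (graph n i j M) (graph n j k N) \<inter> axes n {i, k} \<longleftrightarrow> v \<in> graph n i k (N * M)"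
  proof
    assume "v \<in> vsum (graph n i j M) (graph n j k N) \<inter> axes n {i, k}"
    then obtain a where v: "v \<in> carrier_vec (3 * n)" "part n j v = 0\<^sub>v n"
      and a: "a \<in> graph n i j M" "v - a \<in> graph n j k N"
      using mem_vsum[OF s] by (auto simp: x)
    have a0: "a \<in> carrier_vec (3 * n)" "part n k a = 0\<^sub>v n" "part n j a = - (M *\<^sub>v part n i a)"
      and va: "part n i (v - a) = 0\<^sub>v n"
      using a by (simp_all add: g1 g2)
    have ak: "part n k (v - a) = part n k v"
      using a0 v m by (simp add: part_diff vec_simps[OF part_carrier])
    have "part n i v = part n i a"
      using va a0(1) v m by (simp add: part_diff vec_simps[OF part_carrier])
    hence aj: "part n j (v - a) = M *\<^sub>v part n i v"
      using a0 v m c by (simp add: part_diff vec_simps[OF c] vec_simps(3)[of "- (M *\<^sub>v part n i a)" n])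
    with ak have "part n k v = - (N *\<^sub>v (M *\<^sub>v part n i v))" using a by (simp add: g2)
    thus "v \<in> graph n i k (N * M)"
      using v assoc_mult_mat_vec[OF N M, of "part n i v"] by (simp add: g3)
  next
    assume "v \<in> graph n i k (N * M)"
    hence v: "v \<in> carrier_vec (3 * n)" "part n j v = 0\<^sub>v n" "part n k v = - (N *\<^sub>v (M *\<^sub>v part n i v))"
      using assoc_mult_mat_vec[OF N M, of "part n i v"] by (simp_all add: g3)
    obtain a where a: "a \<in> carrier_vec (3 * n)" "part n i a = part n i v"
      "part n j a = - (M *\<^sub>v part n i v)" "part n k a = 0\<^sub>v n"
      using ex_parts[OF T part_carrier _ zero_carrier_vec] c uminus_carrier_vec by metis
    have "a \<in> graph n i j M" using a by (simp add: g1)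
    moreover have "part n i (v - a) = 0\<^sub>v n" "part n k (v - a) = part n k v"
      using a v(1) m by (simp_all add: part_diff vec_simps[OF part_carrier])
    moreover have "part n j (v - a) = M *\<^sub>v part n i v"
      using a v m c by (simp_all add: part_diff vec_simps[OF part_carrier] vec_simps[OF c] vec_simps(3)[of "- (M *\<^sub>v part n i v)" n])
    ultimately have "a \<in> graph n i j M" "v - a \<in> graph n j k N" using a v by (simp_all add: g2)
    thus "v \<in> vsum (graph n i j M) (graph n j k N) \<inter> axes n {i, k}"
      using mem_vsum[OF s] v by (auto simp: x)
  qed
qed

text \<open>The first sum consists of the vectors (x, y - Kx, -y). The cylinder over the graph of
  \<open>M\<close> forces y = Mx, so the middle part becomes -(K - M)x. Adding the axis
  \<open>k\<close> and cutting with the plane of \<open>i, j\<close> erases the last part. The sign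
  in the frame element is why a difference comes out rather than a sum.\<close>

lemma graph_diff:
  assumes T: "triple i j k" and K: "K \<in> carrier_mat n n" and M: "M \<in> carrier_mat n n"
  shows "vsum (vsum (graph n i j K) (graph n j k (1\<^sub>m n)) \<inter> vsum (graph n i k M) (axes n {j})) (axes n {k})
      \<inter> axes n {i, j} = graph n i j (K - M)"
proof (rule Set.set_eqI)
  fix v :: "rat vec"
  let ?X = "vsum (graph n i j K) (graph n j k (1\<^sub>m n))" and ?Y = "vsum (graph n i k M) (axes n {j})"
  note m = triple_mem[OF T]
  have s: "lin_subspace (3 * n) (graph n i j K)" "lin_subspace (3 * n) (graph n j k (1\<^sub>m n))"
    "lin_subspace (3 * n) (graph n i k M)"
    using K M m by (simp_all add: lin_subspace_graph)
  have sXY: "lin_subspace (3 * n) (?X \<inter> ?Y)"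
    using s lin_subspace_axes by (intro lin_subspace_Int lin_subspace_vsum)
  note g1 = mem_graph[OF T] and g2 = mem_graph[OF triple_perm(4)[OF T]]
    and y = mem_vsum_graph_axes[OF triple_perm(2)[OF T] M]
    and x = mem_axes(2)[OF T] and z = mem_axes(1)[OF triple_perm(5)[OF T]]
  have c: "K *\<^sub>v part n i w \<in> carrier_vec n" "M *\<^sub>v part n i w \<in> carrier_vec n" for w
    using M K by (auto intro: mult_mat_vec_carrier)
  have KM: "(K - M) *\<^sub>v part n i w = K *\<^sub>v part n i w - M *\<^sub>v part n i w" for w
    using K M by (intro minus_mult_distrib_mat_vec) auto
  show "v \<in> vsum (?X \<inter> ?Y) (axes n {k}) \<inter> axes n {i, j} \<longleftrightarrow> v \<in> graph n i j (K - M)"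
  proof
    assume "v \<in> vsum (?X \<inter> ?Y) (axes n {k}) \<inter> axes n {i, j}"
    then obtain a where v: "v \<in> carrier_vec (3 * n)" "part n k v = 0\<^sub>v n"
      and a: "a \<in> ?X" "a \<in> ?Y" "v - a \<in> axes n {k}"
      using mem_vsum[OF sXY lin_subspace_axes] by (auto simp: x)
    obtain b where b: "b \<in> graph n i j K" "a - b \<in> graph n j k (1\<^sub>m n)"
      using a mem_vsum[OF s(1,2)] by blast
    have ac: "a \<in> carrier_vec (3 * n)" and bc: "b \<in> carrier_vec (3 * n)" using a y b g1 by blast+
    have "part n i v = part n i a" "part n j v = part n j a"
      using a ac v m by (simp_all add: z part_diff vec_simps[OF part_carrier])
    moreover have "part n k a = - (M *\<^sub>v part n i a)" using a y by blast
    moreover have "part n i a = part n i b"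
      using b ac bc m by (simp add: g2 part_diff vec_simps[OF part_carrier])
    moreover have "part n k a - part n k b = - (1\<^sub>m n *\<^sub>v (part n j a - part n j b))"
      using b ac bc m by (simp add: g2 part_diff)
    hence "part n k a = - (part n j a - part n j b)"
      using b by (simp add: g1 vec_simps[OF part_carrier])
    moreover have "part n j b = - (K *\<^sub>v part n i b)" using b by (simp add: g1)
    ultimately have e: "- (M *\<^sub>v part n i v) = - (part n j v - - (K *\<^sub>v part n i v))"
      by metis
    have "p = - (r - q)" if "- q = - (p - - r)" "p \<in> carrier_vec n" "q \<in> carrier_vec n" "r \<in> carrier_vec n"
      for p q r :: "rat vec"
      using that by (auto simp: vec_eq_iff)
    from this[OF e part_carrier c(2,1)]
    have "part n j v = - (K *\<^sub>v part n i v - M *\<^sub>v part n i v)" .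
    thus "v \<in> graph n i j (K - M)" using v KM by (simp add: g1)
  next
    assume "v \<in> graph n i j (K - M)"
    hence v: "v \<in> carrier_vec (3 * n)" "part n k v = 0\<^sub>v n"
      "part n j v = - (K *\<^sub>v part n i v - M *\<^sub>v part n i v)"
      by (simp_all add: g1 KM)
    obtain b where b: "b \<in> carrier_vec (3 * n)" "part n i b = part n i v"
      "part n j b = - (K *\<^sub>v part n i v)" "part n k b = 0\<^sub>v n"
      using ex_parts[OF T part_carrier _ zero_carrier_vec] c uminus_carrier_vec by metis
    obtain a where a: "a \<in> carrier_vec (3 * n)" "part n i a = part n i v"
      "part n j a = part n j v" "part n k a = - (M *\<^sub>v part n i v)"
      using ex_parts[OF T part_carrier part_carrier] c uminus_carrier_vec by metis
    have "part n j v - - (K *\<^sub>v part n i v) = M *\<^sub>v part n i v"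
    proof -
      have "- (r - q) - - r = q" if "q \<in> carrier_vec n" "r \<in> carrier_vec n" for q r :: "rat vec"
        using that by (auto simp: vec_eq_iff)
      thus ?thesis unfolding v(3) using c by blast
    qed
    hence "a - b \<in> graph n j k (1\<^sub>m n)"
      using a b m c[of v] by (simp add: g2 part_diff vec_simps[OF part_carrier] vec_simps(2)[of _ n])
    moreover have "b \<in> graph n i j K" using b by (simp add: g1)
    ultimately have "a \<in> ?X" using mem_vsum[OF s(1,2)] a by blast
    moreover have "a \<in> ?Y" using a by (simp add: y)
    moreover have "v - a \<in> axes n {k}"
      using v(1,2) a m by (simp add: z part_diff vec_simps[OF part_carrier])
    ultimately show "v \<in> vsum (?X \<inter> ?Y) (axes n {k}) \<inter> axes n {i, j}"
      using mem_vsum[OF sXY lin_subspace_axes] v by (auto simp: x)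
  qed
qed

text \<open>One and the same relation read in both directions: y = -Mx is solved for x by x =
  -Ny.\<close>

lemma graph_inverse:
  assumes T: "triple i j k" and c: "M \<in> carrier_mat n n" "N \<in> carrier_mat n n"
    and inv: "M * N = 1\<^sub>m n" "N * M = 1\<^sub>m n"
  shows "graph n i j M = graph n j i N"
proof (rule Set.set_eqI)
  fix v :: "rat vec"
  have neg: "A *\<^sub>v (- x) = - (A *\<^sub>v x)" if "A \<in> carrier_mat n n" "x \<in> carrier_vec n" for A :: "rat mat" and x
    using that by (auto simp: vec_eq_iff)
  have MN: "M *\<^sub>v (N *\<^sub>v x) = x" "N *\<^sub>v (M *\<^sub>v x) = x" if "x \<in> carrier_vec n" for x
    using that c assoc_mult_mat_vec[OF c that] assoc_mult_mat_vec[OF c(2,1) that] by (simp_all add: inv)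
  have "y = - (M *\<^sub>v x) \<longleftrightarrow> x = - (N *\<^sub>v y)" if "x \<in> carrier_vec n" "y \<in> carrier_vec n" for x y
  proof -
    have "M *\<^sub>v x \<in> carrier_vec n" "N *\<^sub>v y \<in> carrier_vec n"
      using c that by (auto intro: mult_mat_vec_carrier)
    thus ?thesis using that c by (auto simp: neg MN vec_simps)
  qed
  thus "v \<in> graph n i j M \<longleftrightarrow> v \<in> graph n j i N"
    unfolding mem_graph[OF T] mem_graph[OF triple_perm(1)[OF T]] by auto
qed

lemma graph_one_sym: "triple i j k \<Longrightarrow> graph n i j (1\<^sub>m n) = graph n j i (1\<^sub>m n)"
  by (rule graph_inverse) auto

section \<open>Frame relations between axes and graphs\<close>

lemma axes_Int_graph_one:
  assumes T: "triple i j k"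
  shows "axes n {i} \<inter> graph n i j (1\<^sub>m n) = axes n {}"
proof -
  have "v = 0\<^sub>v (3 * n)" if "v \<in> axes n {i}" "v \<in> graph n i j (1\<^sub>m n)" for v
    by (rule triple_eqI[OF T, where n = n])
      (use that triple_mem[OF T] in \<open>simp_all add: mem_axes[OF T] mem_graph[OF T] part_zero vec_simps[OF part_carrier]\<close>)
  moreover have "0\<^sub>v (3 * n) \<in> axes n {i}" "0\<^sub>v (3 * n) \<in> graph n i j (1\<^sub>m n)"
    using lin_subspaceD(2)[OF lin_subspace_axes] lin_subspaceD(2)[OF lin_subspace_graph]
      triple_mem[OF T] by auto
  ultimately show ?thesis unfolding axes_empty by blast
qed

lemma vsum_axes_graph_one:
  assumes T: "triple i j k"
  shows "vsum (axes n {i}) (graph n i j (1\<^sub>m n)) = axes n {i, j}"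
proof
  note m = triple_mem[OF T]
  have s: "lin_subspace (3 * n) (graph n i j (1\<^sub>m n))"
    using m by (simp add: lin_subspace_graph)
  show "vsum (axes n {i}) (graph n i j (1\<^sub>m n)) \<subseteq> axes n {i, j}"
    by (rule vsum_least[OF lin_subspace_axes]) (auto simp: axes_def graph_def)
  show "axes n {i, j} \<subseteq> vsum (axes n {i}) (graph n i j (1\<^sub>m n))"
  proof
    fix v assume v: "v \<in> axes n {i, j}"
    \<comment> \<open>The decomposition is (p, q) = (p + q, 0) + (-q, q), where p and q are parts
      \<open>i\<close> and \<open>j\<close> of \<open>v\<close>.\<close>
    obtain x where x: "x \<in> carrier_vec (3 * n)" "part n i x = part n i v + part n j v"
      "part n j x = 0\<^sub>v n" "part n k x = 0\<^sub>v n"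
      using ex_parts[OF T _ zero_carrier_vec zero_carrier_vec] part_carrier add_carrier_vec by metis
    have "part n j v = - (part n i v - (part n i v + part n j v))"
      using part_carrier[of n i v] part_carrier[of n j v] by (auto simp: vec_eq_iff)
    hence "v - x \<in> graph n i j (1\<^sub>m n)"
      using x v m by (simp add: mem_axes(2)[OF T] mem_graph[OF T] part_diff vec_simps[OF part_carrier])
    moreover have "x \<in> axes n {i}" using x by (simp add: mem_axes[OF T])
    ultimately show "v \<in> vsum (axes n {i}) (graph n i j (1\<^sub>m n))"
      using mem_vsum[OF lin_subspace_axes s] v by (auto simp: mem_axes(2)[OF T])
  qed
qed

section \<open>Block diagonal forms\<close>

definition block_form :: "nat \<Rightarrow> (nat \<Rightarrow> rat mat) \<Rightarrow> rat vec \<Rightarrow> rat vec \<Rightarrow> rat" where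
  "block_form n A x y = (\<Sum>i\<in>{1..3}. part n i x \<bullet> (A i *\<^sub>v part n i y))"

text \<open>With the first block normalized to the identity, complementation yields
  \<open>A j\<close> itself rather than its product with the inverse of \<open>A 1\<close>.\<close>

locale block_forms =
  fixes n :: nat and A :: "nat \<Rightarrow> rat mat"
  assumes n_pos: "0 < n"
    and A_carrier [simp]: "A i \<in> carrier_mat n n"
    and A_sym: "transpose_mat (A i) = A i"
    and A_pos: "x \<in> carrier_vec n \<Longrightarrow> x \<noteq> 0\<^sub>v n \<Longrightarrow> 0 < x \<bullet> (A i *\<^sub>v x)"
    and A_1: "A 1 = 1\<^sub>m n"
begin

lemma A_mult_carrier [simp]: "x \<in> carrier_vec n \<Longrightarrow> A i *\<^sub>v x \<in> carrier_vec n"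
  by (rule mult_mat_vec_carrier[OF A_carrier])

lemma A_mult_zero [simp]: "A i *\<^sub>v 0\<^sub>v n = 0\<^sub>v n"
  using carrier_matD[OF A_carrier[of i]] by (intro eq_vecI) auto

lemma A_adjoint:
  assumes "x \<in> carrier_vec n" "y \<in> carrier_vec n"
  shows "x \<bullet> (A i *\<^sub>v y) = (A i *\<^sub>v x) \<bullet> y"
  using transpose_vec_mult_scalar[OF A_carrier assms(2,1)] by (simp add: A_sym)

lemma symmetric_block_form: "symmetric_bilinear_form (3 * n) (block_form n A)"
proof -
  have sym: "block_form n A x y = block_form n A y x" for x y
    unfolding block_form_def
  proof (rule sum.cong[OF refl])
    fix i
    show "part n i x \<bullet> (A i *\<^sub>v part n i y) = part n i y \<bullet> (A i *\<^sub>v part n i x)"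
      using comm_scalar_prod[of "A i *\<^sub>v part n i x" n "part n i y"] by (simp add: A_adjoint)
  qed
  have add: "block_form n A (x + y) z = block_form n A x z + block_form n A y z"
    if "x \<in> carrier_vec (3 * n)" "y \<in> carrier_vec (3 * n)" for x y z
    unfolding block_form_def sum.distrib[symmetric] using that
    by (intro sum.cong refl) (simp add: part_add add_scalar_prod_distrib[of _ n])
  have smult: "block_form n A (c \<cdot>\<^sub>v x) z = c * block_form n A x z"
    if "x \<in> carrier_vec (3 * n)" for c x z
    unfolding block_form_def sum_distrib_left using that
    by (intro sum.cong refl) (simp add: part_smult smult_scalar_prod_distrib[of _ n])
  show ?thesis unfolding symmetric_bilinear_form_def
  proof (intro conjI ballI allI)
    fix c and x y z :: "rat vec"
    assume x: "x \<in> carrier_vec (3 * n)" and y: "y \<in> carrier_vec (3 * n)"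
    show "block_form n A x y = block_form n A y x" by (rule sym)
    show "block_form n A (c \<cdot>\<^sub>v x) y = c * block_form n A x y" by (rule smult[OF x])
    show "block_form n A x (c \<cdot>\<^sub>v y) = c * block_form n A x y"
      unfolding sym[of x] by (rule smult[OF y])
    show "block_form n A (x + y) z = block_form n A x z + block_form n A y z"
      by (rule add[OF x y])
    assume z: "z \<in> carrier_vec (3 * n)"
    show "block_form n A x (y + z) = block_form n A x y + block_form n A x z"
      unfolding sym[of x] by (rule add[OF y z])
  qed
qed

lemma definite_block_form: "positive_definite (3 * n) (block_form n A)"
  unfolding positive_definite_def
proof (intro ballI impI)
  fix x :: "rat vec" assume x: "x \<in> carrier_vec (3 * n)" "x \<noteq> 0\<^sub>v (3 * n)"
  have nonneg: "0 \<le> part n i x \<bullet> (A i *\<^sub>v part n i x)" for i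
    using A_pos[of "part n i x" i] by (cases "part n i x = 0\<^sub>v n") auto
  obtain i where i: "i \<in> {1..3}" "part n i x \<noteq> 0\<^sub>v n"
    using part_eqI[OF x(1) zero_carrier_vec] x(2) part_zero by metis
  show "0 < block_form n A x x"
    unfolding block_form_def
    by (rule sum_pos2[OF _ i(1)]) (use A_pos[of "part n i x" i] i nonneg in auto)
qed

sublocale definite_form "3 * n" "block_form n A"
  by unfold_locales (rule symmetric_block_form definite_block_form)+

lemma block_form_triple:
  assumes "triple i j k"
  shows "block_form n A x y = part n i x \<bullet> (A i *\<^sub>v part n i y)
    + part n j x \<bullet> (A j *\<^sub>v part n j y) + part n k x \<bullet> (A k *\<^sub>v part n k y)"
proof -
  have "i \<noteq> j" "j \<noteq> k" "i \<noteq> k" using assms by (simp_all add: triple_def)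
  thus ?thesis unfolding block_form_def triple_set(1)[OF assms] by simp
qed

lemma axes_orthogonal:
  assumes "triple j k l"
  shows "axes n {j} \<subseteq> perp (axes n {k})"
proof
  fix y assume "y \<in> axes n {j}"
  thus "y \<in> perp (axes n {k})"
    unfolding mem_axes(1)[OF assms] mem_Collect_eq mem_axes(1)[OF triple_perm(1)[OF assms]] Ball_def
    by (simp add: block_form_triple[OF assms])
qed

text \<open>Pairing (v_1, v_j) with (x, -x) gives (v_1 - A_j v_j) \<bullet> x, so orthogonality to
  all x means v_1 = A_j v_j. Read from block \<open>j\<close> to block 1, with the sign of
  \<open>graph\<close>, the matrix is \<open>- A j\<close>. This is how the form enters the
  coordinate ring.\<close>

lemma graph_one_perp:
  assumes T: "triple 1 j k"
  shows "perp (graph n 1 j (1\<^sub>m n)) \<inter> axes n {1, j} = graph n j 1 (- A j)"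
proof (rule Set.set_eqI)
  fix v :: "rat vec"
  define r where "r = part n 1 v - A j *\<^sub>v part n j v"
  have rc: "r \<in> carrier_vec n" by (simp add: r_def)
  have form_v: "block_form n A v x = r \<bullet> part n 1 x"
    if "x \<in> graph n 1 j (1\<^sub>m n)" "part n k v = 0\<^sub>v n" for x
  proof -
    have x: "part n k x = 0\<^sub>v n" "part n j x = - part n 1 x"
      using that(1)[unfolded mem_graph[OF T]] by simp_all
    have "block_form n A v x = part n 1 v \<bullet> part n 1 x + (A j *\<^sub>v part n j v) \<bullet> (- part n 1 x)"
      unfolding block_form_triple[OF T] A_1 x that(2)
      by (simp add: A_adjoint)
    also have "\<dots> = r \<bullet> part n 1 x"
      unfolding r_def by (simp add: minus_scalar_prod_distrib[of _ n] carrier_matD[OF A_carrier])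
    finally show ?thesis .
  qed
  have "v \<in> perp (graph n 1 j (1\<^sub>m n)) \<longleftrightarrow> r = 0\<^sub>v n"
    if v: "v \<in> carrier_vec (3 * n)" "part n k v = 0\<^sub>v n"
  proof
    assume p: "v \<in> perp (graph n 1 j (1\<^sub>m n))"
    \<comment> \<open>Testing against (r, -r) gives r \<bullet> r = 0.\<close>
    obtain x where x: "x \<in> carrier_vec (3 * n)" "part n 1 x = r" "part n j x = - r" "part n k x = 0\<^sub>v n"
      using ex_parts[OF T rc _ zero_carrier_vec] uminus_carrier_vec rc by metis
    have "x \<in> graph n 1 j (1\<^sub>m n)" unfolding mem_graph[OF T] using x rc by simp
    hence "r \<bullet> r = 0" using p form_v[OF _ v(2)] x by auto
    thus "r = 0\<^sub>v n" using A_pos[of r 1, unfolded A_1] rc by auto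
  next
    assume "r = 0\<^sub>v n"
    thus "v \<in> perp (graph n 1 j (1\<^sub>m n))" using form_v[OF _ v(2)] v by auto
  qed
  moreover have "r = 0\<^sub>v n \<longleftrightarrow> part n 1 v = - ((- A j) *\<^sub>v part n j v)"
    unfolding r_def by (simp add: vec_simps(8)[of _ n] vec_simps(4)[of _ n] carrier_matD[OF A_carrier])
  ultimately show "v \<in> perp (graph n 1 j (1\<^sub>m n)) \<inter> axes n {1, j} \<longleftrightarrow> v \<in> graph n j 1 (- A j)"
    unfolding Int_iff mem_axes(2)[OF T] mem_graph[OF triple_perm(1)[OF T]] by blast
qed

section \<open>The coordinate ring of the generated ortholattice\<close>

text \<open>The frame in block terms, which keeps spans out of the coordinate calculations;
  \<open>frame_set_tilde\<close> identifies it with the given subspaces.\<close>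

definition frame_set :: "rat vec set set" where
  "frame_set = (\<lambda>i. axes n {i}) ` {1..3} \<union>
     {graph n i j (1\<^sub>m n) | i j. i \<in> {1..3} \<and> j \<in> {1..3} \<and> i \<noteq> j}"

abbreviation G where "G \<equiv> ortho_generated L frame_set"

text \<open>Needed to read the operations in \<open>G\<close> as sums and intersections, since those
  descriptions hold for subspaces.\<close>

lemma G_lin_subspace: "X \<in> G \<Longrightarrow> lin_subspace (3 * n) X"
proof (induction rule: ortho_generated.induct)
  case (base X)
  thus ?case by (auto simp: frame_set_def lin_subspace_axes lin_subspace_graph)
next
  case (ocompl X)
  hence "lin_subspace (3 * n) (perp X)" by (intro lin_subspace_perp) (auto dest: lin_subspaceD(1))
  thus ?case by simp
qed (simp_all add: join_L meet_L bottom_L top_L lin_subspace_vsum lin_subspace_Int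
    lin_subspace_zero lin_subspace_carrier)

lemma G_vsum: "X \<in> G \<Longrightarrow> Y \<in> G \<Longrightarrow> vsum X Y \<in> G"
  using ortho_generated.join[of X L frame_set Y] by (simp add: join_L G_lin_subspace)

lemma G_Int: "X \<in> G \<Longrightarrow> Y \<in> G \<Longrightarrow> X \<inter> Y \<in> G"
  using ortho_generated.meet[of X L frame_set Y] by (simp add: meet_L G_lin_subspace)

lemma G_perp: "X \<in> G \<Longrightarrow> perp X \<in> G"
  using ortho_generated.ocompl[of X L frame_set] by simp

lemma G_axes: "i \<in> {1..3} \<Longrightarrow> axes n {i} \<in> G"
  by (rule ortho_generated.base) (auto simp: frame_set_def)

lemma G_axes2: "triple i j k \<Longrightarrow> axes n {i, j} \<in> G"
  using axes_one_one[of i j k n] G_vsum[OF G_axes G_axes, of i j] triple_mem[of i j k] by simp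

lemma G_graph_one: "triple i j k \<Longrightarrow> graph n i j (1\<^sub>m n) \<in> G"
  by (rule ortho_generated.base) (auto simp: frame_set_def triple_def)

text \<open>Requiring all six ordered pairs of blocks lets the ring operations pick whichever
  positions they need; by \<open>R_I\<close> a single position is enough for membership.\<close>

definition R :: "rat mat set" where
  "R = {M \<in> carrier_mat n n. \<forall>i j k. triple i j k \<longrightarrow> graph n i j M \<in> G}"

lemma R_carrier: "M \<in> R \<Longrightarrow> M \<in> carrier_mat n n" by (simp add: R_def)

lemma R_graph: "M \<in> R \<Longrightarrow> triple i j k \<Longrightarrow> graph n i j M \<in> G" by (auto simp: R_def)

lemma G_comp:
  assumes "triple i j k" "M \<in> carrier_mat n n" "N \<in> carrier_mat n n"
    "graph n i j M \<in> G" "graph n j k N \<in> G"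
  shows "graph n i k (N * M) \<in> G"
  unfolding graph_comp[OF assms(1-3), symmetric]
  using assms G_axes2[OF triple_perm(2)[OF assms(1)]] by (intro G_Int G_vsum)

text \<open>Composing with the frame elements moves a graph to any other pair of blocks.\<close>

lemma R_I:
  assumes T: "triple i j k" and M: "M \<in> carrier_mat n n" and g: "graph n i j M \<in> G"
  shows "M \<in> R"
proof -
  have target: "graph n i k M \<in> G" if "triple i j k" "graph n i j M \<in> G" for i j k
    using G_comp[OF that(1) M one_carrier_mat that(2) G_graph_one[OF triple_perm(4)[OF that(1)]]] M
    by simp
  have source: "graph n k j M \<in> G" if "triple i j k" "graph n i j M \<in> G" for i j k
    using G_comp[OF triple_perm(5)[OF that(1)] one_carrier_mat M
        G_graph_one[OF triple_perm(5)[OF that(1)]] that(2)] M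
    by simp
  note T2 = triple_perm[OF T]
  have ik: "graph n i k M \<in> G" using target[OF T g] .
  have kj: "graph n k j M \<in> G" using source[OF T g] .
  have jk: "graph n j k M \<in> G" using source[OF T2(2) ik] .
  have ki: "graph n k i M \<in> G" using target[OF T2(3) kj] .
  have ji: "graph n j i M \<in> G" using target[OF T2(4) jk] .
  have "graph n a b M \<in> G" if "triple a b c" for a b c
  proof -
    have "a \<in> {i, j, k}" "b \<in> {i, j, k}" "a \<noteq> b"
      using that unfolding triple_set(1)[OF T, symmetric] by (simp_all add: triple_def)
    thus ?thesis using g ik kj jk ki ji by blast
  qed
  thus ?thesis using M unfolding R_def by blast
qed

lemma R_one: "1\<^sub>m n \<in> R"
  using R_I[OF triple_123(1) one_carrier_mat G_graph_one[OF triple_123(1)]] .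

text \<open>The factors are composed through block 2: \<open>N\<close> runs from block 1 to 2, then
  \<open>M\<close> from 2 to 3.\<close>

lemma R_mult:
  assumes "M \<in> R" "N \<in> R"
  shows "M * N \<in> R"
proof -
  have c: "M \<in> carrier_mat n n" "N \<in> carrier_mat n n" using assms R_carrier by auto
  show ?thesis
    using R_I[OF triple_perm(2)[OF triple_123(1)] mult_carrier_mat[OF c]]
      G_comp[OF triple_123(1) c(2,1) R_graph[OF assms(2) triple_123(1)]
        R_graph[OF assms(1) triple_perm(4)[OF triple_123(1)]]] by simp
qed

lemma R_diff:
  assumes "M \<in> R" "N \<in> R"
  shows "M - N \<in> R"
proof -
  note T = triple_123(1)
  have c: "M \<in> carrier_mat n n" "N \<in> carrier_mat n n" using assms R_carrier by auto
  have "graph n 1 2 (M - N) \<in> G"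
    unfolding graph_diff[OF T c, symmetric]
    using R_graph[OF assms(1) T] R_graph[OF assms(2) triple_123(2)]
      G_graph_one[OF triple_perm(4)[OF T]] G_axes2[OF T] G_axes
    by (intro G_Int G_vsum) simp_all
  thus ?thesis by (rule R_I[OF T minus_carrier_mat[OF c(2)]])
qed

lemma R_inverse:
  assumes "M \<in> R" "N \<in> carrier_mat n n" "M * N = 1\<^sub>m n" "N * M = 1\<^sub>m n"
  shows "N \<in> R"
  using graph_inverse[OF triple_123(1) R_carrier[OF assms(1)] assms(2-4)]
    R_graph[OF assms(1) triple_123(1)] R_I[OF triple_perm(1)[OF triple_123(1)] assms(2)] by simp

lemma A_in_R:
  assumes T: "triple 1 j k"
  shows "A j \<in> R"
proof -
  have "graph n j 1 (- A j) \<in> G"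
    unfolding graph_one_perp[OF T, symmetric]
    by (intro G_Int G_perp G_graph_one[OF T] G_axes2[OF T])
  hence "- A j \<in> R" using R_I[OF triple_perm(1)[OF T]] by simp
  \<comment> \<open>Negation is a difference from zero, and zero is 1 - 1.\<close>
  hence "1\<^sub>m n - 1\<^sub>m n - (- A j) \<in> R" by (intro R_diff R_one)
  moreover have "1\<^sub>m n - 1\<^sub>m n - (- A j) = A j"
    using carrier_matD[OF A_carrier[of j]] by (intro eq_matI) auto
  ultimately show ?thesis by simp
qed

section \<open>Generating all subspaces\<close>

text \<open>The column \<open>a\<close> times the transposed unit vector with index
  \<open>p\<close>.\<close>

definition rank_one :: "rat vec \<Rightarrow> nat \<Rightarrow> rat mat" where
  "rank_one a p = mat n n (\<lambda>(i, j). if j = p then a $ i else 0)"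

lemma rank_one_carrier [simp]: "rank_one a p \<in> carrier_mat n n"
  by (simp add: rank_one_def)

lemma rank_one_mult:
  assumes "a \<in> carrier_vec n" "u \<in> carrier_vec n" "p < n"
  shows "rank_one a p *\<^sub>v u = (u $ p) \<cdot>\<^sub>v a"
  using assms
  by (intro eq_vecI)
    (auto simp: rank_one_def scalar_prod_def if_distrib[of "\<lambda>x. x * _"] sum.delta cong: if_cong)

text \<open>The axis meets a graph in the kernel of its matrix. Freeing the other two blocks turns
  this into a condition on the first part alone, which is how a ring element constrains a single
  block.\<close>

lemma mem_vsum_kernel:
  assumes M: "M \<in> carrier_mat n n"
  shows "w \<in> vsum (axes n {1} \<inter> graph n 1 2 M) (axes n {2, 3}) \<longleftrightarrow>
    w \<in> carrier_vec (3 * n) \<and> M *\<^sub>v part n 1 w = 0\<^sub>v n"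
proof -
  note T = triple_123(1)
  have s: "lin_subspace (3 * n) (axes n {1} \<inter> graph n 1 2 M)"
    using M by (simp add: lin_subspace_Int lin_subspace_axes lin_subspace_graph)
  have c: "M *\<^sub>v part n 1 u \<in> carrier_vec n" for u
    using M by (auto intro: mult_mat_vec_carrier)
  have X: "u \<in> axes n {1} \<inter> graph n 1 2 M \<longleftrightarrow> u \<in> carrier_vec (3 * n) \<and> part n 2 u = 0\<^sub>v n
      \<and> part n 3 u = 0\<^sub>v n \<and> M *\<^sub>v part n 1 u = 0\<^sub>v n" for u
    unfolding Int_iff mem_axes(1)[OF T] mem_graph[OF T] using vec_simps(6)[OF c[of u]] by metis
  note Y = mem_axes(2)[OF triple_perm(4)[OF T]]
  show ?thesis
  proof
    assume "w \<in> vsum (axes n {1} \<inter> graph n 1 2 M) (axes n {2, 3})"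
    then obtain x where w: "w \<in> carrier_vec (3 * n)"
      and x: "x \<in> axes n {1} \<inter> graph n 1 2 M" "w - x \<in> axes n {2, 3}"
      using mem_vsum[OF s lin_subspace_axes] by blast
    have x': "x \<in> carrier_vec (3 * n)" "part n 1 (w - x) = 0\<^sub>v n" "M *\<^sub>v part n 1 x = 0\<^sub>v n"
      using x(1)[unfolded X] x(2)[unfolded Y] by blast+
    hence "part n 1 w = part n 1 x"
      using w by (simp add: part_diff vec_simps[OF part_carrier])
    thus "w \<in> carrier_vec (3 * n) \<and> M *\<^sub>v part n 1 w = 0\<^sub>v n" using w x' by simp
  next
    assume w: "w \<in> carrier_vec (3 * n) \<and> M *\<^sub>v part n 1 w = 0\<^sub>v n"
    obtain x where x: "x \<in> carrier_vec (3 * n)" "part n 1 x = part n 1 w"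
      "part n 2 x = 0\<^sub>v n" "part n 3 x = 0\<^sub>v n"
      using ex_parts[OF T part_carrier zero_carrier_vec zero_carrier_vec] by metis
    have "x \<in> axes n {1} \<inter> graph n 1 2 M"
      unfolding X using x w by simp
    moreover have "w - x \<in> axes n {2, 3}"
      using x w by (simp add: Y part_diff vec_simps[OF part_carrier])
    ultimately show "w \<in> vsum (axes n {1} \<inter> graph n 1 2 M) (axes n {2, 3})"
      using mem_vsum[OF s lin_subspace_axes] w by blast
  qed
qed

text \<open>Coordinate \<open>p\<close> of the first part recovers the factor of a multiple of
  \<open>v\<close>. Membership in the line then says that each part of \<open>w\<close> is that
  factor times the part of \<open>v\<close>: one linear condition per block, each cut out by a rank
  one matrix.\<close>

lemma G_line_nonzero:
  assumes full: "R = carrier_mat n n"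
    and v: "v \<in> carrier_vec (3 * n)" and p: "p < n" "part n 1 v $ p \<noteq> 0"
  shows "line v \<in> G"
proof -
  note T = triple_123(1)
  define c where "c = inverse (part n 1 v $ p)"
  \<comment> \<open>The kernel of \<open>K\<close> is the line of the first part of
    \<open>v\<close>, since the subtracted matrix projects onto it. The minus sign in
    \<open>M\<close> cancels the one in \<open>graph\<close>.\<close>
  define K where "K = 1\<^sub>m n - rank_one (c \<cdot>\<^sub>v part n 1 v) p"
  define M where "M l = rank_one (- (c \<cdot>\<^sub>v part n l v)) p" for l
  let ?K = "vsum (axes n {1} \<inter> graph n 1 2 K) (axes n {2, 3})"
  let ?M = "\<lambda>l m. vsum (graph n 1 l (M l)) (axes n {m})"
  have Kc: "K \<in> carrier_mat n n" and Mc: "M l \<in> carrier_mat n n" for l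
    by (simp_all add: K_def M_def minus_carrier_mat)
  have K_iff: "K *\<^sub>v u = 0\<^sub>v n \<longleftrightarrow> u = (u $ p * c) \<cdot>\<^sub>v part n 1 v" if "u \<in> carrier_vec n" for u
    using that p unfolding K_def
    by (simp add: minus_mult_distrib_mat_vec[of _ n n] rank_one_mult smult_smult_assoc vec_simps(8)[of _ n])
  have M_mult: "- (M l *\<^sub>v u) = (u $ p * c) \<cdot>\<^sub>v part n l v" if "u \<in> carrier_vec n" for u l
    using that p unfolding M_def by (subst rank_one_mult) (auto simp: vec_eq_iff part_def)
  have mem: "w \<in> ?K \<inter> ?M 2 3 \<inter> ?M 3 2 \<longleftrightarrow> w \<in> carrier_vec (3 * n) \<and>
      (\<forall>l\<in>{1, 2, 3}. part n l w = (part n 1 w $ p * c) \<cdot>\<^sub>v part n l v)" for w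
    unfolding Int_iff mem_vsum_kernel[OF Kc] mem_vsum_graph_axes[OF T Mc]
      mem_vsum_graph_axes[OF triple_123(2) Mc] K_iff[OF part_carrier] M_mult[OF part_carrier]
    by auto
  have "line v = ?K \<inter> ?M 2 3 \<inter> ?M 3 2"
  proof
    show "line v \<subseteq> ?K \<inter> ?M 2 3 \<inter> ?M 3 2"
    proof
      fix w assume "w \<in> line v"
      then obtain b where w: "w = b \<cdot>\<^sub>v v" by (auto simp: line_def)
      have "part n l w = b \<cdot>\<^sub>v part n l v" if "l \<in> {1, 2, 3}" for l
        unfolding w using that by (intro part_smult[OF v]) auto
      moreover have "part n 1 w $ p * c = b"
        using p part_carrier[of n 1 v] calculation[of 1] by (simp add: c_def)
      ultimately show "w \<in> ?K \<inter> ?M 2 3 \<inter> ?M 3 2" unfolding mem using v w by simp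
    qed
    show "?K \<inter> ?M 2 3 \<inter> ?M 3 2 \<subseteq> line v"
    proof
      fix w assume "w \<in> ?K \<inter> ?M 2 3 \<inter> ?M 3 2"
      hence w: "w \<in> carrier_vec (3 * n)"
        "\<forall>l\<in>{1, 2, 3}. part n l w = (part n 1 w $ p * c) \<cdot>\<^sub>v part n l v" unfolding mem by auto
      have "w = (part n 1 w $ p * c) \<cdot>\<^sub>v v"
        by (rule triple_eqI[OF T w(1)])
          (use v w(2)[rule_format, of 1] w(2)[rule_format, of 2] w(2)[rule_format, of 3]
           in \<open>simp_all add: part_smult\<close>)
      thus "w \<in> line v" unfolding line_def by blast
    qed
  qed
  moreover have "graph n 1 2 K \<in> G" "graph n 1 2 (M 2) \<in> G" "graph n 1 3 (M 3) \<in> G"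
    using R_graph[of _ 1 2 3] R_graph[of _ 1 3 2] triple_123 Kc Mc full by auto
  ultimately show ?thesis
    using G_axes G_axes2[OF triple_perm(4)[OF T]] by (simp add: G_Int G_vsum)
qed

text \<open>If the first part of \<open>v\<close> vanishes, no coordinate there can serve as factor.
  Shifting by a vector \<open>x\<close> with nonzero first part gives two lines covered by the
  previous case; in the plane they span, the vectors with zero first part are the multiples of
  \<open>v\<close>.\<close>

lemma G_line:
  assumes full: "R = carrier_mat n n" and v: "v \<in> carrier_vec (3 * n)"
  shows "line v \<in> G"
proof (cases "part n 1 v = 0\<^sub>v n")
  case False
  then obtain p where "p < n" "part n 1 v $ p \<noteq> 0"
    by (auto simp: vec_eq_iff part_def)
  thus ?thesis using G_line_nonzero[OF full v] by blast
next
  case True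
  note True' = True[unfolded One_nat_def]
  note T = triple_123(1)
  obtain x where x: "x \<in> carrier_vec (3 * n)" "part n 1 x = unit_vec n 0"
    using ex_parts[OF T _ zero_carrier_vec zero_carrier_vec] unit_vec_carrier by metis
  have p: "part n 1 x $ 0 = 1" "part n 1 (x + v) $ 0 = 1"
    using x v n_pos by (simp_all add: part_add True')
  note Y = mem_axes(2)[OF triple_perm(4)[OF T]]
  have "line v = vsum (line (x + v)) (line x) \<inter> axes n {2, 3}"
  proof
    show "line v \<subseteq> vsum (line (x + v)) (line x) \<inter> axes n {2, 3}"
    proof
      fix w assume "w \<in> line v"
      then obtain c where w: "w = c \<cdot>\<^sub>v v" by (auto simp: line_def)
      have "c \<cdot>\<^sub>v 0\<^sub>v n = 0\<^sub>v n" by (intro eq_vecI) auto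
      hence "w \<in> axes n {2, 3}"
        unfolding w Y using v by (simp add: part_smult True')
      moreover have "w = c \<cdot>\<^sub>v (x + v) + (- c) \<cdot>\<^sub>v x"
        unfolding w using x v by (intro eq_vecI) (auto simp: algebra_simps)
      ultimately show "w \<in> vsum (line (x + v)) (line x) \<inter> axes n {2, 3}"
        unfolding vsum_def line_def by blast
    qed
    show "vsum (line (x + v)) (line x) \<inter> axes n {2, 3} \<subseteq> line v"
    proof
      fix w assume w: "w \<in> vsum (line (x + v)) (line x) \<inter> axes n {2, 3}"
      then obtain a b where ab: "w = a \<cdot>\<^sub>v (x + v) + b \<cdot>\<^sub>v x"
        unfolding vsum_def line_def by blast
      have "part n 1 w $ 0 = a + b"
        unfolding ab using x v p n_pos by (simp add: part_add part_smult True')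
      moreover have "part n 1 w $ 0 = 0" using w n_pos by (simp add: Y)
      ultimately have "b = - a" by simp
      hence "w = a \<cdot>\<^sub>v v"
        unfolding ab using x v by (intro eq_vecI) (auto simp: algebra_simps)
      thus "w \<in> line v" unfolding line_def by blast
    qed
  qed
  moreover have "line x \<in> G" "line (x + v) \<in> G"
    using G_line_nonzero[OF full] x v p n_pos by (metis zero_neq_one add_carrier_vec)+
  ultimately show ?thesis using G_axes2[OF triple_perm(4)[OF T]] by (simp add: G_Int G_vsum)
qed

lemma G_eq_carrier:
  assumes full: "R = carrier_mat n n"
  shows "G = carrier L"
proof -
  have "W \<in> G" if "lin_subspace (3 * n) W" for W
    using that
  proof (induction rule: lin_subspace_induct)
    case zero
    show ?case using ortho_generated.bottom[of L frame_set] by (simp add: bottom_L)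
  next
    case (line W b)
    thus ?case using G_line[OF full] G_vsum by blast
  qed
  thus ?thesis using G_lin_subspace by auto
qed

end

section \<open>The frame\<close>

text \<open>Serves both families of the frame, each being the image of Q^n under a linear map. The
  nontrivial inclusion switches on the coordinates of \<open>x\<close> one at a time.\<close>

lemma span_linear_image:
  assumes f_carrier: "\<And>x. x \<in> carrier_vec n \<Longrightarrow> f x \<in> carrier_vec d"
    and f_add: "\<And>x y. x \<in> carrier_vec n \<Longrightarrow> y \<in> carrier_vec n \<Longrightarrow> f (x + y) = f x + f y"
    and f_smult: "\<And>c x. x \<in> carrier_vec n \<Longrightarrow> f (c \<cdot>\<^sub>v x) = c \<cdot>\<^sub>v f x"
    and W: "lin_subspace d (f ` carrier_vec n)"
  shows "LinearCombinations.module.span class_ring (module_vec TYPE('a::field) d) ((\<lambda>t. f (unit_vec n t)) ` {..<n})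
    = f ` carrier_vec n"
proof -
  interpret vec_space "TYPE('a)" d .
  let ?B = "(\<lambda>t. f (unit_vec n t)) ` {..<n}"
  have B: "?B \<subseteq> carrier_vec d" using f_carrier by auto
  have s: "lin_subspace d (span ?B)"
    using span_is_subspace[of ?B] B unfolding lin_subspace_iff by simp
  have "f x \<in> span ?B" if x: "x \<in> carrier_vec n" for x
  proof -
    have "f (vec n (\<lambda>t. if t < m then x $ t else 0)) \<in> span ?B" if "m \<le> n" for m
      using that
    proof (induction m)
      case 0
      have "vec n (\<lambda>t. if t < 0 then x $ t else 0) = 0 \<cdot>\<^sub>v x" using x by (intro eq_vecI) auto
      moreover have "f (0 \<cdot>\<^sub>v x) = 0\<^sub>v d"
        using x f_carrier[OF x] unfolding f_smult[OF x] by (intro eq_vecI) auto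
      ultimately show ?case using lin_subspaceD(2)[OF s] by simp
    next
      case (Suc m)
      have "vec n (\<lambda>t. if t < Suc m then x $ t else 0)
          = vec n (\<lambda>t. if t < m then x $ t else 0) + x $ m \<cdot>\<^sub>v unit_vec n m"
        using Suc by (intro eq_vecI) (auto simp: less_Suc_eq)
      hence e: "f (vec n (\<lambda>t. if t < Suc m then x $ t else 0))
          = f (vec n (\<lambda>t. if t < m then x $ t else 0)) + x $ m \<cdot>\<^sub>v f (unit_vec n m)"
        by (simp add: f_add f_smult)
      have "f (unit_vec n m) \<in> span ?B" using Suc in_own_span[of ?B] B by auto
      thus ?case unfolding e using Suc lin_subspaceD(3,4)[OF s] by simp
    qed
    from this[of n] have "f (vec n (\<lambda>t. if t < n then x $ t else 0)) \<in> span ?B" by simp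
    moreover have "vec n (\<lambda>t. if t < n then x $ t else 0) = x" using x by (intro eq_vecI) auto
    ultimately show ?thesis by simp
  qed
  moreover have "span ?B \<subseteq> f ` carrier_vec n"
  proof (rule span_is_subset)
    show "submodule class_ring (f ` carrier_vec n) V"
      using W unfolding lin_subspace_iff[symmetric] by (rule VectorSpace.subspace.submod)
  qed auto
  ultimately show ?thesis by blast
qed

definition embed :: "nat \<Rightarrow> nat \<Rightarrow> rat vec \<Rightarrow> rat vec" where
  "embed n i x = vec (3 * n) (\<lambda>s. if s div n = i - 1 then x $ (s mod n) else 0)"

lemma embed_carrier [simp]: "embed n i x \<in> carrier_vec (3 * n)"
  by (simp add: embed_def)

lemma embed_linear:
  assumes "x \<in> carrier_vec n"
  shows "y \<in> carrier_vec n \<Longrightarrow> embed n i (x + y) = embed n i x + embed n i y"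
    and "embed n i (c \<cdot>\<^sub>v x) = c \<cdot>\<^sub>v embed n i x"
  using assms block_index(1)[of _ n] by (auto simp: embed_def intro!: eq_vecI)

lemma part_embed:
  assumes "x \<in> carrier_vec n" "i \<in> {1..3}" "l \<in> {1..3}"
  shows "part n l (embed n i x) = (if l = i then x else 0\<^sub>v n)"
  using assms part_less[OF _ assms(3)] by (intro eq_vecI) (auto simp: part_def embed_def)

text \<open>The shift by one reconciles coordinates counted from 0 with basis vectors counted from
  1.\<close>

lemma embed_unit:
  assumes t: "t < n" and i: "i \<in> {1..3}"
  shows "embed n i (unit_vec n t) = std_basis_vec (3 * n) (t + 1 + (i - 1) * n)"
proof (rule eq_vecI)
  fix s assume "s < dim_vec (std_basis_vec (3 * n) (t + 1 + (i - 1) * n))"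
  hence s: "s < 3 * n" by (simp add: std_basis_vec_def)
  have "s = t + (i - 1) * n \<longleftrightarrow> s div n = i - 1 \<and> s mod n = t"
  proof
    assume "s div n = i - 1 \<and> s mod n = t"
    thus "s = t + (i - 1) * n" using mod_div_mult_eq[of s n] by metis
  qed (use t in simp)
  thus "embed n i (unit_vec n t) $ s = std_basis_vec (3 * n) (t + 1 + (i - 1) * n) $ s"
    using s block_index(1)[OF s] part_less[OF t i] t by (auto simp: embed_def std_basis_vec_def)
qed (simp add: embed_def std_basis_vec_def)

lemma E_tilde_eq:
  assumes T: "triple i j k"
  shows "E_tilde n i = axes n {i}"
proof -
  note m = triple_mem[OF T] and d = T[unfolded triple_def]
  have image: "embed n i ` carrier_vec n = axes n {i}"
  proof
    show "embed n i ` carrier_vec n \<subseteq> axes n {i}"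
      using m d by (auto simp: mem_axes(1)[OF T] part_embed)
    show "axes n {i} \<subseteq> embed n i ` carrier_vec n"
    proof
      fix v assume v: "v \<in> axes n {i}"
      have "v = embed n i (part n i v)"
        by (rule triple_eqI[OF T, where n = n]) (use v m d in \<open>simp_all add: mem_axes(1)[OF T] part_embed\<close>)
      thus "v \<in> embed n i ` carrier_vec n" using part_carrier by blast
    qed
  qed
  have "(\<lambda>t. std_basis_vec (3 * n) (t + (i - 1) * n)) ` {1..n}
      = (\<lambda>t. embed n i (unit_vec n t)) ` {..<n}"
    unfolding image_Suc_lessThan[symmetric] image_image
    by (rule image_cong) (use m in \<open>simp_all add: embed_unit\<close>)
  thus ?thesis unfolding E_tilde_def image[symmetric]
    by (simp only:) (rule span_linear_image, auto simp: embed_linear image lin_subspace_axes)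
qed

lemma E2_tilde_eq:
  assumes T: "triple i j k"
  shows "E2_tilde n i j = graph n i j (1\<^sub>m n)"
proof -
  \<comment> \<open>The vectors with \<open>x\<close> in block \<open>i\<close> and
    \<open>- x\<close> in block \<open>j\<close>, matching the sign built into
    \<open>graph\<close>.\<close>
  define f where "f x = embed n i x - embed n j x" for x
  note m = triple_mem[OF T] and d = T[unfolded triple_def]
  have part_f: "part n l (f x) = part n l (embed n i x) - part n l (embed n j x)" if "l \<in> {1..3}" for l x
    using that by (simp add: f_def part_diff)
  have image: "f ` carrier_vec n = graph n i j (1\<^sub>m n)"
  proof
    show "f ` carrier_vec n \<subseteq> graph n i j (1\<^sub>m n)"
      using m d by (auto simp: mem_graph[OF T] part_f part_embed vec_simps[of _ n]) (simp add: f_def)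
    show "graph n i j (1\<^sub>m n) \<subseteq> f ` carrier_vec n"
    proof
      fix v assume v: "v \<in> graph n i j (1\<^sub>m n)"
      have "v = f (part n i v)"
        by (rule triple_eqI[OF T, where n = n])
          (use v m d in \<open>simp_all add: mem_graph[OF T] part_f part_embed vec_simps[OF part_carrier], simp_all add: f_def\<close>)
      thus "v \<in> f ` carrier_vec n" using part_carrier by blast
    qed
  qed
  have "(\<lambda>t. std_basis_vec (3 * n) (t + (i - 1) * n) - std_basis_vec (3 * n) (t + (j - 1) * n)) ` {1..n}
      = (\<lambda>t. f (unit_vec n t)) ` {..<n}"
    unfolding image_Suc_lessThan[symmetric] image_image f_def
    by (rule image_cong) (use m in \<open>simp_all add: embed_unit\<close>)
  moreover have "f (x + y) = f x + f y" if "x \<in> carrier_vec n" "y \<in> carrier_vec n" for x y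
    using that by (auto simp: f_def embed_linear vec_eq_iff embed_def)
  moreover have "f (c \<cdot>\<^sub>v x) = c \<cdot>\<^sub>v f x" if "x \<in> carrier_vec n" for c x
    using that by (auto simp: f_def embed_linear vec_eq_iff embed_def algebra_simps)
  moreover have "f x \<in> carrier_vec (3 * n)" for x by (simp add: f_def)
  ultimately show ?thesis unfolding E2_tilde_def image[symmetric] using m
    by (simp only:) (rule span_linear_image, auto simp: image lin_subspace_graph)
qed

section \<open>Verification of the frame laws\<close>

context block_forms begin

lemma orthogonal_frame_tilde: "orthogonal_frame L 3 (E_tilde n) (E2_tilde n)"
proof -
  have E: "E_tilde n i = axes n {i}" if i: "i \<in> {1..3}" for i
  proof -
    have "\<exists>j\<in>{1..3}. i \<noteq> j" by (rule bexI[of _ "if i = 1 then 2 else 1"]) auto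
    then obtain j where "j \<in> {1..3}" "i \<noteq> j" by blast
    then obtain k where "triple i j k" using ex_triple i by blast
    thus ?thesis by (rule E_tilde_eq)
  qed
  have one: "1\<^sub>m n \<in> carrier_mat n n" by simp
  have inf: "\<Sqinter>\<^bsub>L\<^esub> (E_tilde n ` {1..3}) = axes n {}"
  proof -
    have "\<Sqinter>\<^bsub>L\<^esub> (E_tilde n ` {1..3}) = \<Inter> (E_tilde n ` {1..3})"
      by (rule inf_L) (auto simp: E lin_subspace_axes)
    also have "\<dots> = axes n {}"
      unfolding triple_set(1)[OF triple_123(1)] using E by (auto simp: axes_def)
    finally show ?thesis .
  qed
  have main: "E_tilde n j \<sqinter>\<^bsub>L\<^esub> (\<Squnion>\<^bsub>L\<^esub> (E_tilde n ` ({1..3} - {j}))) = \<Sqinter>\<^bsub>L\<^esub> (E_tilde n ` {1..3}) \<and>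
        \<Sqinter>\<^bsub>L\<^esub> (E_tilde n ` {1..3}) = E_tilde n j \<sqinter>\<^bsub>L\<^esub> E2_tilde n j k \<and>
        E_tilde n j \<squnion>\<^bsub>L\<^esub> E2_tilde n j k = E_tilde n j \<squnion>\<^bsub>L\<^esub> E_tilde n k \<and>
        E2_tilde n j l = E2_tilde n l j \<and>
        E2_tilde n l j = (E_tilde n j \<squnion>\<^bsub>L\<^esub> E_tilde n l) \<sqinter>\<^bsub>L\<^esub> (E2_tilde n j k \<squnion>\<^bsub>L\<^esub> E2_tilde n k l)"
    if T: "triple j k l" for j k l
  proof (intro conjI)
    note P = triple_perm[OF T] and m = triple_mem[OF T]
    note eqs = E_tilde_eq[OF T] E_tilde_eq[OF P(1)] E_tilde_eq[OF P(3)]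
      E2_tilde_eq[OF T] E2_tilde_eq[OF P(2)] E2_tilde_eq[OF P(5)] E2_tilde_eq[OF P(4)]
    have sg: "lin_subspace (3 * n) (graph n a b (1\<^sub>m n))" if "a \<in> {1..3}" "b \<in> {1..3}" for a b
      using that by (simp add: lin_subspace_graph)
    have sup: "\<Squnion>\<^bsub>L\<^esub> (E_tilde n ` ({1..3} - {j})) = axes n {k, l}"
      unfolding triple_set(2)[OF T] image_insert image_empty eqs join_def[symmetric]
      by (simp add: join_L lin_subspace_axes axes_one_one[OF P(4)])
    show "E_tilde n j \<sqinter>\<^bsub>L\<^esub> (\<Squnion>\<^bsub>L\<^esub> (E_tilde n ` ({1..3} - {j}))) = \<Sqinter>\<^bsub>L\<^esub> (E_tilde n ` {1..3})"
      unfolding sup inf eqs meet_L[OF lin_subspace_axes lin_subspace_axes]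
    proof (rule Set.set_eqI)
      fix v
      show "v \<in> axes n {j} \<inter> axes n {k, l} \<longleftrightarrow> v \<in> axes n {}"
        unfolding axes_def triple_set(1)[OF T] using T[unfolded triple_def] by auto
    qed
    show "\<Sqinter>\<^bsub>L\<^esub> (E_tilde n ` {1..3}) = E_tilde n j \<sqinter>\<^bsub>L\<^esub> E2_tilde n j k"
      unfolding inf eqs using m by (simp add: meet_L lin_subspace_axes sg axes_Int_graph_one[OF T])
    show "E_tilde n j \<squnion>\<^bsub>L\<^esub> E2_tilde n j k = E_tilde n j \<squnion>\<^bsub>L\<^esub> E_tilde n k"
      unfolding eqs using m
      by (simp add: join_L lin_subspace_axes sg vsum_axes_graph_one[OF T] axes_one_one[OF T])
    show sym: "E2_tilde n j l = E2_tilde n l j"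
      unfolding eqs by (rule graph_one_sym[OF P(2)])
    \<comment> \<open>The last frame law is multiplication of graphs for 1 * 1 = 1, after exchanging
      \<open>l\<close> and \<open>j\<close> by symmetry.\<close>
    show "E2_tilde n l j = (E_tilde n j \<squnion>\<^bsub>L\<^esub> E_tilde n l) \<sqinter>\<^bsub>L\<^esub> (E2_tilde n j k \<squnion>\<^bsub>L\<^esub> E2_tilde n k l)"
      unfolding sym[symmetric] unfolding eqs using m graph_comp[OF T one one]
      by (simp add: join_L meet_L lin_subspace_axes lin_subspace_vsum sg axes_one_one[OF P(2)] Int_commute)
  qed
  have E2_closed: "E2_tilde n i j \<in> carrier L"
    and orth: "E_tilde n i \<sqsubseteq>\<^bsub>L\<^esub> ocompl L (E_tilde n j)"
    if ij: "i \<in> {1..3}" "j \<in> {1..3}" "i \<noteq> j" for i j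
  proof -
    obtain k where T: "triple i j k" using ex_triple[OF ij] by blast
    show "E2_tilde n i j \<in> carrier L" using ij by (simp add: E2_tilde_eq[OF T] lin_subspace_graph)
    show "E_tilde n i \<sqsubseteq>\<^bsub>L\<^esub> ocompl L (E_tilde n j)"
      unfolding E[OF ij(1)] E[OF ij(2)] L_simps by (rule axes_orthogonal[OF T])
  qed
  have E_closed: "E_tilde n i \<in> carrier L" if "i \<in> {1..3}" for i
    using E[OF that] by (simp add: lin_subspace_axes)
  have "frame L 3 (E_tilde n) (E2_tilde n)"
    unfolding frame_def
  proof (intro conjI[OF order_refl] conjI)
    show "\<forall>i\<in>{1..3}. E_tilde n i \<in> carrier L" using E_closed by blast
    show "\<forall>i\<in>{1..3}. \<forall>j\<in>{1..3}. i \<noteq> j \<longrightarrow> E2_tilde n i j \<in> carrier L" using E2_closed by blast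
  qed (intro ballI impI main, unfold triple_def, blast)
  thus ?thesis unfolding orthogonal_frame_def using orth by blast
qed

lemma frame_set_tilde:
  "frame_set = E_tilde n ` {1..3} \<union> {E2_tilde n i j | i j. i \<in> {1..3} \<and> j \<in> {1..3} \<and> i \<noteq> j}"
proof -
  have "E_tilde n ` {1..3} = (\<lambda>i. axes n {i}) ` {1..3}"
    unfolding triple_set(1)[OF triple_123(1)]
    using E_tilde_eq[OF triple_123(1)] E_tilde_eq[OF triple_perm(4)[OF triple_123(1)]]
      E_tilde_eq[OF triple_perm(5)[OF triple_123(1)]] by simp
  moreover have E2: "E2_tilde n i j = graph n i j (1\<^sub>m n)"
    if ij: "i \<in> {1..3} \<and> j \<in> {1..3} \<and> i \<noteq> j" for i j
  proof -
    obtain k where "triple i j k" using ex_triple ij by blast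
    thus ?thesis by (rule E2_tilde_eq)
  qed
  have "{E2_tilde n i j | i j. i \<in> {1..3} \<and> j \<in> {1..3} \<and> i \<noteq> j}
      = {graph n i j (1\<^sub>m n) | i j. i \<in> {1..3} \<and> j \<in> {1..3} \<and> i \<noteq> j}"
    by (rule Collect_cong, rule ex_cong1, rule ex_cong1, rule rev_conj_cong, rule refl, subst E2, assumption, rule refl)
  ultimately show ?thesis unfolding frame_set_def by simp
qed

end

text \<open>The diagonal entries start at 1, so they are positive as well as distinct. The final
  branch serves index 1 and also indices that name no block, because the locale makes its demands on
  every index.\<close>

definition form_matrix :: "nat \<Rightarrow> nat \<Rightarrow> rat mat" where
  "form_matrix n i =
    (if i = 2 then mat n n (\<lambda>(a, b). if a = b then of_nat (a + 1) else 0)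
     else if i = 3 then 1\<^sub>m n + mat n n (\<lambda>_. 1) else 1\<^sub>m n)"

text \<open>The weights cover the identity (all 1) and the diagonal matrix (\<open>t + 1\<close>)
  together.\<close>

lemma scalar_prod_self_pos:
  fixes x :: "rat vec"
  assumes "x \<in> carrier_vec n" "x \<noteq> 0\<^sub>v n" "\<And>t. t < n \<Longrightarrow> 0 < c t"
  shows "0 < (\<Sum>t<n. c t * (x $ t * x $ t))"
proof -
  obtain t where t: "t < n" "x $ t \<noteq> 0" using assms by (auto simp: vec_eq_iff)
  have "x $ t * x $ t > 0" using t by (auto simp: zero_less_mult_iff linorder_neq_iff)
  hence "0 < c t * (x $ t * x $ t)" using assms(3)[OF t(1)] by simp
  moreover have "0 \<le> c i * (x $ i * x $ i)" if "i < n" for i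
    by (rule mult_nonneg_nonneg[OF less_imp_le[OF assms(3)[OF that]] zero_le_square])
  ultimately show ?thesis using t by (intro sum_pos2[of _ t]) auto
qed

lemma block_forms_form_matrix:
  assumes "0 < n"
  shows "block_forms n (form_matrix n)"
proof
  fix i
  show "form_matrix n i \<in> carrier_mat n n" by (simp add: form_matrix_def)
  show "transpose_mat (form_matrix n i) = form_matrix n i"
    by (intro eq_matI) (auto simp: form_matrix_def)
  fix x :: "rat vec" assume x: "x \<in> carrier_vec n" "x \<noteq> 0\<^sub>v n"
  have one: "0 < x \<bullet> x"
    using scalar_prod_self_pos[OF x, of "\<lambda>_. 1"] x
    by (simp add: scalar_prod_def atLeast0LessThan)
  have two: "x \<bullet> (mat n n (\<lambda>(a, b). if a = b then of_nat (a + 1) else 0) *\<^sub>v x)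
      = (\<Sum>t<n. of_nat (t + 1) * (x $ t * x $ t))"
    using x by (auto simp: scalar_prod_def atLeast0LessThan if_distrib[of "\<lambda>x. x * _"] sum.delta
        cong: if_cong intro!: sum.cong)
  \<comment> \<open>The all-ones matrix contributes the square of the coordinate sum, which is
    nonnegative but may vanish.\<close>
  have three: "x \<bullet> (mat n n (\<lambda>_. 1) *\<^sub>v x) = (\<Sum>t<n. x $ t) * (\<Sum>t<n. x $ t)"
    using x by (simp add: scalar_prod_def atLeast0LessThan sum_distrib_right)
  have add: "x \<bullet> ((1\<^sub>m n + mat n n (\<lambda>_. 1)) *\<^sub>v x) = x \<bullet> x + x \<bullet> (mat n n (\<lambda>_. 1) *\<^sub>v x)"
  proof -
    have J: "mat n n (\<lambda>_. 1) \<in> carrier_mat n n" by simp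
    show ?thesis
      unfolding add_mult_distrib_mat_vec[OF one_carrier_mat J x(1)] one_mult_mat_vec[OF x(1)]
      by (rule scalar_prod_add_distrib[OF x(1) x(1) mult_mat_vec_carrier[OF J x(1)]])
  qed
  have "0 < (\<Sum>t<n. of_nat (t + 1) * (x $ t * x $ t))"
    by (rule scalar_prod_self_pos[OF x]) simp
  moreover have "0 < x \<bullet> x + x \<bullet> (mat n n (\<lambda>_. 1) *\<^sub>v x)"
    using one unfolding three by (simp add: add_pos_nonneg)
  ultimately show "0 < x \<bullet> (form_matrix n i *\<^sub>v x)"
    using one x by (simp add: form_matrix_def two add)
qed (use assms in \<open>simp_all add: form_matrix_def\<close>)

theorem proposition4p15:
  fixes n k :: nat
  assumes "n = 2 ^ k"
  shows "\<exists>\<Phi> :: rat vec \<Rightarrow> rat vec \<Rightarrow> rat.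
           symmetric_bilinear_form (3 * n) \<Phi> \<and>
           positive_definite (3 * n) \<Phi> \<and>
           modular_ortholattice (subspace_ortholattice (3 * n) \<Phi>) \<and>
           orthogonal_frame (subspace_ortholattice (3 * n) \<Phi>) 3 (E_tilde n) (E2_tilde n) \<and>
           ortho_generated (subspace_ortholattice (3 * n) \<Phi>)
             (E_tilde n ` {1..3} \<union> {E2_tilde n i j | i j. i \<in> {1..3} \<and> j \<in> {1..3} \<and> i \<noteq> j})
             = carrier (subspace_ortholattice (3 * n) \<Phi>)"
proof -
  interpret block_forms n "form_matrix n"
    using assms by (intro block_forms_form_matrix) simp
  have "form_matrix n 2 \<in> R" "form_matrix n 3 \<in> R"
    using A_in_R triple_123 by blast+
  hence diag: "mat n n (\<lambda>(a, b). if a = b then of_nat (a + 1) else 0) \<in> R"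
    and "1\<^sub>m n + mat n n (\<lambda>_. 1) - 1\<^sub>m n \<in> R"
    using R_diff[OF _ R_one] by (simp_all add: form_matrix_def)
  \<comment> \<open>The summand 1 of the third block is there for positivity; removing it leaves the
    all-ones matrix.\<close>
  moreover have "1\<^sub>m n + mat n n (\<lambda>_. 1) - 1\<^sub>m n = (mat n n (\<lambda>_. 1) :: rat mat)"
    by (intro eq_matI) auto
  ultimately have ones: "mat n n (\<lambda>_. 1) \<in> R" by simp
  have "R = carrier_mat n n"
    by (rule rat_mat_subring_full[OF _ R_one R_diff R_mult R_inverse diag ones]) (auto dest: R_carrier)
  hence "G = carrier L" by (rule G_eq_carrier)
  thus ?thesis
    using symmetric_block_form definite_block_form modular_ortholattice_L orthogonal_frame_tilde
    unfolding frame_set_tilde by blast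
qed

end
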